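(* Let $K$ be an algebraically closed field, complete with respect to a nontrivial non-Archimedean absolute value, let $M$ be a nonempty compact totally disconnected Hausdorff topological space, and let $\mathcal B=C(M,K)$ be the Banach space of continuous functions $M\to K$ with the supremum norm. Let $a\in\mathcal B$ and let $A$ be the operator of multiplication by $a$ on $\mathcal B$, $(A\varphi)(m)=a(m)\varphi(m)$. Then $A$ is strongly normal.
   Context: $\|A\|=\sup_{x\ne 0}\|Ax\|/\|x\|$ is the operator norm. For a bounded operator $A$ on a Banach space $\mathcal B$ over $K$, $\mathcal L_A$ denotes the commutative Banach algebra generated by $A$ and $I$, i.e. the closure, in the operator norm, of the algebra $K[A]$ of polynomials in $A$ with coefficients in $K$. Its (Berkovich) spectrum $\mathcal M(\mathcal L_A)$ is the set of all bounded multiplicative seminorms on $\mathcal L_A$, with the weakest topology for which all the functions $|\cdot|\mapsto |B|$, $B\in\mathcal L_A$, are continuous. Each point $x\in\mathcal M(\mathcal L_A)$ defines a character $\mathcal L_A\to\mathcal H(x)$, where $\mathcal H(x)$ is the completion of the fraction field of $\mathcal L_A/\ker x$ with respect to the induced absolute value. Normal operator: $A$ is normal if $\mathcal L_A$ is uniform, i.e. $\|T^2\|=\|T\|^2$ for all $T\in\mathcal L_A$, and all characters of $\mathcal L_A$ take their values in $K$ (i.e. $\mathcal H(x)=K$ for all $x$). In this case $\mathcal M(\mathcal L_A)$ is totally disconnected and $\mathcal L_A$ is isomorphic to the algebra $C(\mathcal M(\mathcal L_A),K)$ of continuous $K$-valued functions with the supremum norm. Strongly normal operator: a normal operator $A$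 whose spectrum $\sigma(A)=\{\lambda\in K: A-\lambda I \text{ has no bounded inverse on }\mathcal B\}$ is a nonempty totally disconnected compact subset of $K$ and for which $\mathcal M(\mathcal L_A)=\sigma(A)$, where a point $x$ of $\mathcal M(\mathcal L_A)$ is identified with the value at $A$ of the corresponding $K$-valued character. *)

theory Defs
  imports "HOL-Analysis.Analysis" "HOL-Algebra.QuotRing"
begin

section \<open>Non-Archimedean valued fields\<close>

text \<open>Together with the metric space axioms, \<open>dist_absval\<close> makes the absolute value nonnegative and
  definite. The topology on the field is the metric topology. (The library constant \<open>norm\<close> is
  restricted to real normed vector spaces.)\<close>

class nonarch_valued_field = Fields.field + metric_space +
  fixes absval :: "'a \<Rightarrow> real"
  assumes dist_absval: "dist x y = absval (x - y)"
    and absval_mult: "absval (x * y) = absval x * absval y"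
    and absval_ultrametric: "absval (x + y) \<le> max (absval x) (absval y)"
    and absval_nontrivial: "\<exists>x. x \<noteq> 0 \<and> absval x \<noteq> 1"

lemma absval_zero: "absval (0::'a::nonarch_valued_field) = 0"
  using dist_absval[of 0 "0::'a"] by simp

lemma absval_nonneg:
  fixes x :: "'a::nonarch_valued_field"
  shows "0 \<le> absval x"
  using dist_absval[of x 0] zero_le_dist[of x 0] by simp

lemma absval_triangle:
  fixes x y :: "'a::nonarch_valued_field"
  shows "absval (x + y) \<le> absval x + absval y"
  using absval_ultrametric[of x y] absval_nonneg[of x] absval_nonneg[of y] by linarith

lemma absval_one: "absval (1::'a::nonarch_valued_field) = 1"
proof -
  have "absval (1::'a) \<noteq> 0"
    using dist_absval[of 1 "0::'a"] dist_eq_0_iff[of 1 "0::'a"] by simp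
  then show ?thesis
    using absval_mult[of 1 "1::'a"] by simp
qed

lemma absval_minus:
  fixes x :: "'a::nonarch_valued_field"
  shows "absval (- x) = absval x"
proof -
  have "absval (- 1 :: 'a) * absval (- 1 :: 'a) = 1"
    using absval_mult[of "- 1" "- 1 :: 'a"] absval_one[where 'a = 'a] by simp
  then have "absval (- 1 :: 'a) = 1"
    using absval_nonneg[of "- 1 :: 'a"] square_eq_1_iff[of "absval (- 1 :: 'a)"] by linarith
  then show ?thesis
    using absval_mult[of "- 1" x] by simp
qed

instance nonarch_valued_field \<subseteq> topological_ab_group_add
proof
  fix a b :: 'a
  show "((\<lambda>x. fst x + snd x) \<longlongrightarrow> a + b) (nhds a \<times>\<^sub>F nhds b)"
  proof (rule tendstoI)
    fix e :: real
    assume "0 < e"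
    then have "eventually (\<lambda>x. dist x a < e / 2) (nhds a)"
      "eventually (\<lambda>x. dist x b < e / 2) (nhds b)"
      by (auto simp: eventually_nhds_metric intro!: exI[of _ "e / 2"])
    then show "eventually (\<lambda>x. dist (fst x + snd x) (a + b) < e) (nhds a \<times>\<^sub>F nhds b)"
      unfolding eventually_prod_filter
    proof (intro exI conjI allI impI)
      fix x y :: 'a
      assume "dist x a < e / 2" "dist y b < e / 2"
      moreover have "absval ((x - a) + (y - b)) \<le> absval (x - a) + absval (y - b)"
        by (rule absval_triangle)
      ultimately show "dist (fst (x, y) + snd (x, y)) (a + b) < e"
        by (simp add: dist_absval algebra_simps)
    qed
  qed
next
  fix a :: 'a
  have "dist (- x) (- a) = dist x a" for x
    using absval_minus[of "x - a"] by (simp add: dist_absval)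
  then show "(uminus \<longlongrightarrow> - a) (nhds a)"
    by (auto simp: tendsto_iff eventually_nhds_metric)
qed

instance nonarch_valued_field \<subseteq> topological_semigroup_mult
proof
  fix a b :: 'a
  show "((\<lambda>x. fst x * snd x) \<longlongrightarrow> a * b) (nhds a \<times>\<^sub>F nhds b)"
  proof (rule tendstoI)
    fix e :: real
    assume e: "0 < e"
    define d where "d = min 1 (e / (absval a + absval b + 2))"
    have pos: "absval a + absval b + 2 > 0"
      using absval_nonneg[of a] absval_nonneg[of b] by linarith
    have "d \<le> e / (absval a + absval b + 2)"
      unfolding d_def by (rule min.cobounded2)
    then have d: "0 < d" "d \<le> 1" "d * (absval a + absval b + 2) \<le> e"
      using e pos by (simp_all only: pos_le_divide_eq) (simp_all add: d_def)
    then have "eventually (\<lambda>x. dist x a < d) (nhds a)" "eventually (\<lambda>x. dist x b < d) (nhds b)"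
      by (auto simp: eventually_nhds_metric)
    then show "eventually (\<lambda>x. dist (fst x * snd x) (a * b) < e) (nhds a \<times>\<^sub>F nhds b)"
      unfolding eventually_prod_filter
    proof (intro exI conjI allI impI)
      fix x y :: 'a
      assume xy: "dist x a < d" "dist y b < d"
      have eq: "x * y - a * b = (x - a) * (y - b) + (a * (y - b) + (x - a) * b)"
        by (simp add: algebra_simps)
      have "absval (x * y - a * b) \<le> absval (x - a) * absval (y - b) + (absval a * absval (y - b) + absval (x - a) * absval b)"
        unfolding eq
        by (rule order_trans[OF absval_triangle])
           (use absval_triangle[of "a * (y - b)" "(x - a) * b"] in \<open>simp add: absval_mult\<close>)
      also have "\<dots> \<le> d * 1 + (absval a * d + d * absval b)"
        using xy d absval_nonneg[of a] absval_nonneg[of b] absval_nonneg[of "x - a"] absval_nonneg[of "y - b"]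
        by (intro add_mono mult_mono) (auto simp: dist_absval)
      also have "\<dots> < d * (absval a + absval b + 2)"
        using d by (simp add: algebra_simps)
      finally show "dist (fst (x, y) * snd (x, y)) (a * b) < e"
        using d by (simp add: dist_absval)
    qed
  qed
qed

definition totally_disconnected :: "'a::topological_space set \<Rightarrow> bool" where
  "totally_disconnected S \<longleftrightarrow> (\<forall>C\<subseteq>S. connected C \<longrightarrow> (\<forall>x\<in>C. \<forall>y\<in>C. x = y))"

section \<open>The Berkovich spectrum and the completed residue fields\<close>

text \<open>\<open>R\<close> is a commutative ring and \<open>N\<close> a norm on it. A seminorm is undefined outside the carrier, so
  that equality of points of the spectrum is equality of functions on \<open>R\<close>.\<close>

definition berkovich_points :: "'r ring \<Rightarrow> ('r \<Rightarrow> real) \<Rightarrow> ('r \<Rightarrow> real) set" where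
  "berkovich_points R N = {x \<in> extensional (carrier R).
     (\<forall>f\<in>carrier R. 0 \<le> x f) \<and>
     x \<zero>\<^bsub>R\<^esub> = 0 \<and> x \<one>\<^bsub>R\<^esub> = 1 \<and>
     (\<forall>f\<in>carrier R. \<forall>g\<in>carrier R. x (f \<oplus>\<^bsub>R\<^esub> g) \<le> x f + x g) \<and>
     (\<forall>f\<in>carrier R. \<forall>g\<in>carrier R. x (f \<otimes>\<^bsub>R\<^esub> g) = x f * x g) \<and>
     (\<exists>C. \<forall>f\<in>carrier R. x f \<le> C * N f)}"

definition berkovich_spectrum :: "'r ring \<Rightarrow> ('r \<Rightarrow> real) \<Rightarrow> ('r \<Rightarrow> real) topology" where
  "berkovich_spectrum R N = topology_generated_by
     {{x \<in> berkovich_points R N. x f \<in> U} |f U. f \<in> carrier R \<and> open U}"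

definition seminorm_kernel :: "'r ring \<Rightarrow> ('r \<Rightarrow> real) \<Rightarrow> 'r set" where
  "seminorm_kernel R x = {f \<in> carrier R. x f = 0}"

definition residue_domain :: "'r ring \<Rightarrow> ('r \<Rightarrow> real) \<Rightarrow> 'r set ring" where
  "residue_domain R x = R Quot (seminorm_kernel R x)"

definition residue_absval :: "('r \<Rightarrow> real) \<Rightarrow> 'r set \<Rightarrow> real" where
  "residue_absval x X = (THE r. \<exists>f\<in>X. r = x f)"

definition fraction_rel :: "'d ring \<Rightarrow> (('d \<times> 'd) \<times> ('d \<times> 'd)) set" where
  "fraction_rel D = {((a, b), (c, d)). a \<in> carrier D \<and> b \<in> carrier D - {\<zero>\<^bsub>D\<^esub>} \<and>
     c \<in> carrier D \<and> d \<in> carrier D - {\<zero>\<^bsub>D\<^esub>} \<and> a \<otimes>\<^bsub>D\<^esub> d = c \<otimes>\<^bsub>D\<^esub> b}"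

definition fraction :: "'d ring \<Rightarrow> 'd \<Rightarrow> 'd \<Rightarrow> ('d \<times> 'd) set" where
  "fraction D a b = fraction_rel D `` {(a, b)}"

definition fraction_field :: "'d ring \<Rightarrow> ('d \<times> 'd) set ring" where
  "fraction_field D =
     \<lparr>carrier = (carrier D \<times> (carrier D - {\<zero>\<^bsub>D\<^esub>})) // fraction_rel D,
      mult = (\<lambda>X Y. \<Union>(a, b)\<in>X. \<Union>(c, d)\<in>Y. fraction D (a \<otimes>\<^bsub>D\<^esub> c) (b \<otimes>\<^bsub>D\<^esub> d)),
      one = fraction D \<one>\<^bsub>D\<^esub> \<one>\<^bsub>D\<^esub>,
      zero = fraction D \<zero>\<^bsub>D\<^esub> \<one>\<^bsub>D\<^esub>,
      add = (\<lambda>X Y. \<Union>(a, b)\<in>X. \<Union>(c, d)\<in>Y.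
               fraction D (a \<otimes>\<^bsub>D\<^esub> d \<oplus>\<^bsub>D\<^esub> c \<otimes>\<^bsub>D\<^esub> b) (b \<otimes>\<^bsub>D\<^esub> d))\<rparr>"

definition fraction_absval :: "('d \<Rightarrow> real) \<Rightarrow> ('d \<times> 'd) set \<Rightarrow> real" where
  "fraction_absval v X = (THE r. \<exists>(a, b)\<in>X. r = v a / v b)"

text \<open>The completion of a field \<open>F\<close> with absolute value \<open>v\<close>: Cauchy sequences modulo null sequences.\<close>

definition cauchy_ring :: "'f ring \<Rightarrow> ('f \<Rightarrow> real) \<Rightarrow> (nat \<Rightarrow> 'f) ring" where
  "cauchy_ring F v =
     \<lparr>carrier = {s. range s \<subseteq> carrier F \<and>
        (\<forall>\<epsilon>>0. \<exists>n0. \<forall>m\<ge>n0. \<forall>n\<ge>n0. v (s m \<ominus>\<^bsub>F\<^esub> s n) < \<epsilon>)},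
      mult = (\<lambda>s t n. s n \<otimes>\<^bsub>F\<^esub> t n),
      one = (\<lambda>n. \<one>\<^bsub>F\<^esub>),
      zero = (\<lambda>n. \<zero>\<^bsub>F\<^esub>),
      add = (\<lambda>s t n. s n \<oplus>\<^bsub>F\<^esub> t n)\<rparr>"

definition null_sequences :: "'f ring \<Rightarrow> ('f \<Rightarrow> real) \<Rightarrow> (nat \<Rightarrow> 'f) set" where
  "null_sequences F v = {s \<in> carrier (cauchy_ring F v). (\<lambda>n. v (s n)) \<longlonglongrightarrow> 0}"

definition field_completion :: "'f ring \<Rightarrow> ('f \<Rightarrow> real) \<Rightarrow> (nat \<Rightarrow> 'f) set ring" where
  "field_completion F v = cauchy_ring F v Quot null_sequences F v"

definition completed_residue_field ::
    "'r ring \<Rightarrow> ('r \<Rightarrow> real) \<Rightarrow> (nat \<Rightarrow> ('r set \<times> 'r set) set) set ring" where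
  "completed_residue_field R x =
     field_completion (fraction_field (residue_domain R x)) (fraction_absval (residue_absval x))"

definition berkovich_character ::
    "'r ring \<Rightarrow> ('r \<Rightarrow> real) \<Rightarrow> 'r \<Rightarrow> (nat \<Rightarrow> ('r set \<times> 'r set) set) set" where
  "berkovich_character R x f =
     (let D = residue_domain R x; F = fraction_field D; v = fraction_absval (residue_absval x)
      in null_sequences F v +>\<^bsub>cauchy_ring F v\<^esub>
           (\<lambda>n. fraction D (seminorm_kernel R x +>\<^bsub>R\<^esub> f) \<one>\<^bsub>D\<^esub>))"

section \<open>Operators on Banach spaces over a valued field\<close>

locale nonarch_banach = vector_space smul
  for smul :: "'k::nonarch_valued_field \<Rightarrow> 'b::ab_group_add \<Rightarrow> 'b" +
  fixes nrm :: "'b \<Rightarrow> real"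
  assumes nrm_nonneg: "0 \<le> nrm v"
    and nrm_eq_0_iff: "nrm v = 0 \<longleftrightarrow> v = 0"
    and nrm_scale: "nrm (smul c v) = absval c * nrm v"
    and nrm_ultrametric: "nrm (v + w) \<le> max (nrm v) (nrm w)"
    and nrm_complete:
      "(\<forall>\<epsilon>>0. \<exists>n0. \<forall>m\<ge>n0. \<forall>n\<ge>n0. nrm (s m - s n) < \<epsilon>) \<Longrightarrow> \<exists>l. (\<lambda>n. nrm (s n - l)) \<longlonglongrightarrow> 0"

definition bounded_op ::
    "('k::nonarch_valued_field \<Rightarrow> 'b::ab_group_add \<Rightarrow> 'b) \<Rightarrow> ('b \<Rightarrow> real) \<Rightarrow> ('b \<Rightarrow> 'b) \<Rightarrow> bool" where
  "bounded_op smul nrm T \<longleftrightarrow> Vector_Spaces.linear smul smul T \<and> (\<exists>C. \<forall>v. nrm (T v) \<le> C * nrm v)"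

definition op_norm :: "('b::zero \<Rightarrow> real) \<Rightarrow> ('b \<Rightarrow> 'b) \<Rightarrow> real" where
  "op_norm nrm T = (SUP v\<in>{v. v \<noteq> 0}. nrm (T v) / nrm v)"

definition poly_op ::
    "('k::nonarch_valued_field \<Rightarrow> 'b::ab_group_add \<Rightarrow> 'b) \<Rightarrow> 'k poly \<Rightarrow> ('b \<Rightarrow> 'b) \<Rightarrow> 'b \<Rightarrow> 'b" where
  "poly_op smul p A = (\<lambda>v. \<Sum>i\<le>degree p. smul (coeff p i) ((A ^^ i) v))"

text \<open>The algebra \<open>\<L>\<^sub>A\<close>, as a ring under pointwise addition and composition.\<close>

definition gen_algebra ::
    "('k::nonarch_valued_field \<Rightarrow> 'b::ab_group_add \<Rightarrow> 'b) \<Rightarrow> ('b \<Rightarrow> real) \<Rightarrow> ('b \<Rightarrow> 'b) \<Rightarrow> ('b \<Rightarrow> 'b) ring" where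
  "gen_algebra smul nrm A =
     \<lparr>carrier = {T. bounded_op smul nrm T \<and>
        (\<forall>\<epsilon>>0. \<exists>p. op_norm nrm (\<lambda>v. T v - poly_op smul p A v) < \<epsilon>)},
      mult = (\<circ>), one = id, zero = (\<lambda>v. 0), add = (\<lambda>S T v. S v + T v)\<rparr>"

text \<open>\<open>\<H>(x) = K\<close> means that the canonical map \<open>\<lambda> \<mapsto> \<chi>\<^sub>x(\<lambda>I)\<close> from \<open>K\<close> to \<open>\<H>(x)\<close> is onto; being a
  homomorphism of fields, it is always injective.\<close>

definition normal_op ::
    "('k::nonarch_valued_field \<Rightarrow> 'b::ab_group_add \<Rightarrow> 'b) \<Rightarrow> ('b \<Rightarrow> real) \<Rightarrow> ('b \<Rightarrow> 'b) \<Rightarrow> bool" where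
  "normal_op smul nrm A \<longleftrightarrow>
     nonarch_banach smul nrm \<and> bounded_op smul nrm A \<and>
     (\<forall>T\<in>carrier (gen_algebra smul nrm A). op_norm nrm (T \<circ> T) = (op_norm nrm T)\<^sup>2) \<and>
     (\<forall>x\<in>berkovich_points (gen_algebra smul nrm A) (op_norm nrm).
        carrier (completed_residue_field (gen_algebra smul nrm A) x) =
          range (\<lambda>c. berkovich_character (gen_algebra smul nrm A) x (smul c)))"

definition op_spectrum ::
    "('k::nonarch_valued_field \<Rightarrow> 'b::ab_group_add \<Rightarrow> 'b) \<Rightarrow> ('b \<Rightarrow> real) \<Rightarrow> ('b \<Rightarrow> 'b) \<Rightarrow> 'k set" where
  "op_spectrum smul nrm A = {c. \<not> (\<exists>B. bounded_op smul nrm B \<and>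
     B \<circ> (\<lambda>v. A v - smul c v) = id \<and> (\<lambda>v. A v - smul c v) \<circ> B = id)}"

text \<open>The value at \<open>A\<close> of the \<open>K\<close>-valued character defined by \<open>x\<close>.\<close>

definition character_value ::
    "('k::nonarch_valued_field \<Rightarrow> 'b::ab_group_add \<Rightarrow> 'b) \<Rightarrow> ('b \<Rightarrow> real) \<Rightarrow> ('b \<Rightarrow> 'b) \<Rightarrow> (('b \<Rightarrow> 'b) \<Rightarrow> real) \<Rightarrow> 'k" where
  "character_value smul nrm A x = (THE c.
     berkovich_character (gen_algebra smul nrm A) x A =
     berkovich_character (gen_algebra smul nrm A) x (smul c))"

definition strongly_normal_op ::
    "('k::nonarch_valued_field \<Rightarrow> 'b::ab_group_add \<Rightarrow> 'b) \<Rightarrow> ('b \<Rightarrow> real) \<Rightarrow> ('b \<Rightarrow> 'b) \<Rightarrow> bool" where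
  "strongly_normal_op smul nrm A \<longleftrightarrow>
     normal_op smul nrm A \<and>
     op_spectrum smul nrm A \<noteq> {} \<and>
     totally_disconnected (op_spectrum smul nrm A) \<and>
     compact (op_spectrum smul nrm A) \<and>
     homeomorphic_map (berkovich_spectrum (gen_algebra smul nrm A) (op_norm nrm))
       (top_of_set (op_spectrum smul nrm A)) (character_value smul nrm A)"

section \<open>The space of continuous functions\<close>

typedef (overloaded) ('m, 'k) cfun =
    "{f :: 'm::topological_space \<Rightarrow> 'k::nonarch_valued_field. continuous_on UNIV f}"
  morphisms cfun_apply Abs_cfun
  by (auto intro: exI[of _ "\<lambda>_. 0"])

setup_lifting type_definition_cfun

instantiation cfun :: (topological_space, nonarch_valued_field) ab_group_add
begin

lift_definition zero_cfun :: "('a, 'b) cfun" is "\<lambda>_. 0" by simp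
lift_definition plus_cfun :: "('a, 'b) cfun \<Rightarrow> ('a, 'b) cfun \<Rightarrow> ('a, 'b) cfun"
  is "\<lambda>f g m. f m + g m" by (rule continuous_on_add)
lift_definition uminus_cfun :: "('a, 'b) cfun \<Rightarrow> ('a, 'b) cfun"
  is "\<lambda>f m. - f m" by (rule continuous_on_minus)
lift_definition minus_cfun :: "('a, 'b) cfun \<Rightarrow> ('a, 'b) cfun \<Rightarrow> ('a, 'b) cfun"
  is "\<lambda>f g m. f m - g m" by (rule continuous_on_diff)

instance
  by standard (transfer; simp add: fun_eq_iff algebra_simps)+

end

lift_definition cfun_scale :: "'k::nonarch_valued_field \<Rightarrow> ('m::topological_space, 'k) cfun \<Rightarrow> ('m, 'k) cfun"
  is "\<lambda>c f m. c * f m" by (rule continuous_on_mult') auto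

lift_definition cfun_mult :: "('m::topological_space, 'k::nonarch_valued_field) cfun \<Rightarrow> ('m, 'k) cfun \<Rightarrow> ('m, 'k) cfun"
  is "\<lambda>f g m. f m * g m" by (rule continuous_on_mult')

text \<open>Meaningful for compact domains only.\<close>

definition cfun_norm :: "('m::topological_space, 'k::nonarch_valued_field) cfun \<Rightarrow> real" where
  "cfun_norm f = (SUP m. absval (cfun_apply f m))"

end

theory Submission
  imports Defs
begin

text \<open>Write \<open>S = a(M)\<close>, a compact subset of \<open>K\<close>. Multiplication by \<open>f\<close> has operator norm
  \<open>\<parallel>f\<parallel>\<close>, as the constant function 1 shows, so \<open>\<L>\<^sub>A\<close> consists of the multiplications by the
  uniform limits \<open>f\<close> of the functions \<open>p \<circ> a\<close> with \<open>p\<close> a polynomial (\<open>carrier_gen_algebra\<close>).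
  The supremum norm is multiplicative on squares, which makes \<open>\<L>\<^sub>A\<close> uniform. An operator
  \<open>A - c\<close> is invertible exactly if \<open>a - c\<close> has no zero, so \<open>\<sigma>(A) = S\<close>, and a subset of an
  ultrametric space is totally disconnected.

  The heart of the matter is that every bounded multiplicative seminorm \<open>x\<close> on \<open>\<L>\<^sub>A\<close> is an
  evaluation \<open>f \<mapsto> \<bar>f(m)\<bar>\<close>. By boundedness and density of the polynomials in \<open>A\<close> it is enough to
  find \<open>z \<in> S\<close> with \<open>x(A - z) = 0\<close>, because a polynomial \<open>p\<close> differs from the constant \<open>p(z)\<close>
  by a multiple of \<open>X - z\<close>. Suppose that there is no such \<open>z\<close>, and cover \<open>S\<close> by finitely many
  balls with centres \<open>z\<close> and radii \<open>x(A - z)/2\<close>. Some product \<open>p\<close> of powers of the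
  \<open>X - z\<close>, with the exponents chosen one after the other in the order of increasing \<open>x(A - z)\<close>, then
  satisfies \<open>\<bar>p\<bar> \<le> x(p(A)) / 2\<close> on all of \<open>S\<close>, contradicting \<open>x(p(A)) \<le> sup\<^sub>S \<bar>p\<bar>\<close>.

  Once \<open>x\<close> is the evaluation at \<open>m\<close>, the map \<open>f \<mapsto> f(m)\<close> identifies \<open>\<L>\<^sub>A / ker x\<close> with \<open>K\<close>; taking
  fractions and completing does not enlarge the complete field \<open>K\<close>, hence \<open>\<H>(x) = K\<close> and the character
  of \<open>x\<close> has the value \<open>a(m)\<close> at \<open>A\<close>. So \<open>\<M>(\<L>\<^sub>A) \<rightarrow> S\<close> is a bijection. It is continuous because
  \<open>\<bar>a(m) - z\<bar> = x(A - z)\<close>, and its inverse is continuous because \<open>a\<close> is a closed map and the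
  elements of \<open>\<L>\<^sub>A\<close> are constant on the fibres of \<open>a\<close>.\<close>

section \<open>Absolute values\<close>

lemma absval_power: "absval (x ^ n) = absval (x::'k::nonarch_valued_field) ^ n"
  by (induction n) (simp_all add: absval_one absval_mult)

lemma absval_of_nat_le_one: "absval (of_nat n :: 'k::nonarch_valued_field) \<le> 1"
proof (induction n)
  case 0
  then show ?case by (simp add: absval_zero)
next
  case (Suc n)
  then show ?case
    using absval_ultrametric[of 1 "of_nat n :: 'k"] by (simp add: absval_one)
qed

lemma absval_eq_0_iff: "absval x = 0 \<longleftrightarrow> x = (0::'k::nonarch_valued_field)"
  using dist_absval[of x 0] dist_eq_0_iff[of x 0] by simp

lemma absval_diff_ultrametric:
  "absval (x - y) \<le> max (absval x) (absval (y::'k::nonarch_valued_field))"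
  using absval_ultrametric[of x "- y"] by (simp add: absval_minus)

lemma dist_ultrametric:
  "dist x z \<le> max (dist x y) (dist y (z::'k::nonarch_valued_field))"
  using absval_ultrametric[of "x - y" "y - z"] by (simp add: dist_absval)

lemma absval_diff_le: "\<bar>absval x - absval y\<bar> \<le> absval (x - (y::'k::nonarch_valued_field))"
  using absval_triangle[of "x - y" y] absval_triangle[of "y - x" x] absval_minus[of "x - y"]
  by simp

text \<open>The power trick: a factor of linear growth does not survive taking \<open>n\<close>-th roots. For
  multiplicative seminorms it removes the constant from a bound and turns the triangle inequality into the
  ultrametric one.\<close>

lemma le_if_power_le_linear_times_power:
  fixes y B C :: real
  assumes "0 \<le> y" "0 \<le> B" and bound: "\<And>n. y ^ n \<le> C * (real n + 1) * B ^ n"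
  shows "y \<le> B"
proof (rule ccontr)
  assume "\<not> y \<le> B"
  then have y: "0 < y" and q: "norm (B / y) < 1"
    using assms by simp_all
  have "(\<lambda>n. C * (real n * (B / y) ^ n + (B / y) ^ n)) \<longlonglongrightarrow> C * (0 + 0)"
    by (intro tendsto_intros powser_times_n_limit_0 LIMSEQ_power_zero q)
  moreover have "1 \<le> C * (real n * (B / y) ^ n + (B / y) ^ n)" for n
    using bound[of n] y by (simp add: field_simps power_divide)
  ultimately have "1 \<le> C * (0 + 0)"
    by (intro LIMSEQ_le_const) auto
  then show False by simp
qed

lemma continuous_on_poly:
  fixes f :: "'m::topological_space \<Rightarrow> 'k::nonarch_valued_field"
  assumes "continuous_on S f"
  shows "continuous_on S (\<lambda>m. poly p (f m))"
  by (induction p) (auto intro!: continuous_on_add continuous_on_mult' assms)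

lemma continuous_on_absval:
  "continuous_on S f \<Longrightarrow> continuous_on S (\<lambda>m. absval (f m :: 'k::nonarch_valued_field))"
  using continuous_on_dist[of S f "\<lambda>_. 0"] by (simp add: dist_absval)

lemma tendsto_inverse_valued:
  fixes f :: "'a \<Rightarrow> 'k::nonarch_valued_field"
  assumes f: "(f \<longlongrightarrow> l) F" and l: "l \<noteq> 0"
  shows "((\<lambda>x. inverse (f x)) \<longlongrightarrow> inverse l) F"
proof (rule tendstoI)
  fix e :: real assume e: "0 < e"
  have pos: "0 < absval l"
    using l absval_nonneg[of l] absval_eq_0_iff[of l] by simp
  have "eventually (\<lambda>x. dist (f x) l < min (absval l) (e * (absval l)\<^sup>2)) F"
    using e pos by (intro tendstoD[OF f]) auto
  then show "eventually (\<lambda>x. dist (inverse (f x)) (inverse l) < e) F"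
  proof (rule eventually_mono)
    fix x assume x: "dist (f x) l < min (absval l) (e * (absval l)\<^sup>2)"
    have "absval l \<le> max (absval (f x)) (absval (f x - l))"
      using absval_diff_ultrametric[of "f x" "f x - l"] by simp
    then have le: "absval l \<le> absval (f x)"
      using x by (simp add: dist_absval max_def split: if_splits)
    then have "f x \<noteq> 0"
      using pos absval_zero[where 'a = 'k] by auto
    then have "(inverse (f x) - inverse l) * (f x * l) = - (f x - l)"
      using l by (simp add: field_simps)
    then have "absval (inverse (f x) - inverse l) * (absval (f x) * absval l) = absval (f x - l)"
      by (metis absval_mult absval_minus)
    moreover have "absval (inverse (f x) - inverse l) * (absval l)\<^sup>2
        \<le> absval (inverse (f x) - inverse l) * (absval (f x) * absval l)"
      using le pos absval_nonneg by (intro mult_left_mono) (auto simp: power2_eq_square)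
    ultimately have "absval (inverse (f x) - inverse l) * (absval l)\<^sup>2 < e * (absval l)\<^sup>2"
      using x by (simp add: dist_absval)
    then show "dist (inverse (f x)) (inverse l) < e"
      using pos by (simp add: dist_absval)
  qed
qed

text \<open>The ball around \<open>x\<close> of radius \<open>dist x y\<close> is closed as well as open, so it separates \<open>x\<close>
  from \<open>y\<close>.\<close>

lemma totally_disconnected_valued: "totally_disconnected (S :: 'k::nonarch_valued_field set)"
  unfolding totally_disconnected_def
proof (intro allI impI ballI)
  fix C :: "'k set" and x y assume C: "connected C" "x \<in> C" "y \<in> C"
  show "x = y"
  proof (rule ccontr)
    assume xy: "x \<noteq> y"
    have "ball z (dist x y) \<subseteq> {z. dist x y \<le> dist x z}" if "dist x y \<le> dist x z" for z
    proof
      fix w assume "w \<in> ball z (dist x y)"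
      then show "w \<in> {z. dist x y \<le> dist x z}"
        using that dist_ultrametric[of x z w] by (auto simp: dist_commute)
    qed
    then have "open {z. dist x y \<le> dist x z}"
      unfolding open_contains_ball using xy by (auto intro!: exI[of _ "dist x y"])
    then have "ball x (dist x y) \<inter> C = {} \<or> {z. dist x y \<le> dist x z} \<inter> C = {}"
      by (intro connectedD[OF C(1)]) auto
    moreover have "x \<in> ball x (dist x y) \<inter> C" "y \<in> {z. dist x y \<le> dist x z} \<inter> C"
      using C xy by simp_all
    ultimately show False by blast
  qed
qed

section \<open>Bounded multiplicative seminorms on polynomials\<close>

text \<open>The hypothesis \<open>bounded\<close> says \<open>W p \<le> C * sup\<^sub>S \<bar>p\<bar>\<close>; with an arbitrary upper bound \<open>B\<close>
  instead of the supremum it also forces \<open>S\<close> to be nonempty.\<close>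

locale bounded_poly_seminorm =
  fixes S :: "'k::nonarch_valued_field set" and W :: "'k poly \<Rightarrow> real" and C :: real
  assumes compact: "compact S"
    and nonneg: "0 \<le> W p"
    and one: "W 1 = 1"
    and zero: "W 0 = 0"
    and add: "W (p + q) \<le> W p + W q"
    and mult: "W (p * q) = W p * W q"
    and bounded: "\<forall>z\<in>S. absval (poly p z) \<le> B \<Longrightarrow> W p \<le> C * B"
begin

lemma nonempty: "S \<noteq> {}"
  using bounded[of 1 0] one by auto

lemma power: "W (p ^ n) = W p ^ n"
  by (induction n) (simp_all add: one mult)

text \<open>The bound for \<open>p\<^sup>n\<close> is \<open>W p ^ n \<le> C * B ^ n\<close>, and the power trick removes \<open>C\<close>.\<close>

lemma le_sup:
  assumes "\<forall>z\<in>S. absval (poly p z) \<le> B"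
  shows "W p \<le> B"
proof (rule le_if_power_le_linear_times_power)
  show B: "0 \<le> B"
    using assms nonempty absval_nonneg order_trans by blast
  show "W p ^ n \<le> C * (real n + 1) * B ^ n" for n
  proof -
    have "1 \<le> C"
      using bounded[of 1 1] one by (simp add: absval_one)
    have "W p ^ n = W (p ^ n)"
      by (simp add: power)
    also have "\<dots> \<le> C * B ^ n"
      using assms by (intro bounded) (auto simp: absval_power absval_nonneg power_mono)
    also have "\<dots> \<le> C * (real n + 1) * B ^ n"
      using B \<open>1 \<le> C\<close> by (intro mult_right_mono) (auto simp: algebra_simps)
    finally show ?thesis .
  qed
qed (rule nonneg)

text \<open>The bound \<open>W [:c:] \<le> absval c\<close> holds for \<open>c\<close> and its inverse, and the two products agree.\<close>

lemma const: "W [:c:] = absval c"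
proof (cases "c = 0")
  case False
  have le: "W [:d:] \<le> absval d" for d
    by (rule le_sup) simp
  have "W [:c:] * W [:inverse c:] = 1"
    using mult[of "[:c:]" "[:inverse c:]"] False one by (simp add: one_pCons)
  moreover have "absval c * absval (inverse c) = 1"
    using absval_mult[of c "inverse c"] False by (simp add: absval_one)
  moreover have "W [:c:] * W [:inverse c:] \<le> W [:c:] * absval (inverse c)"
    by (intro mult_left_mono le nonneg)
  ultimately have "absval c * absval (inverse c) \<le> W [:c:] * absval (inverse c)"
    by simp
  moreover have "0 < absval (inverse c)"
    using absval_nonneg[of "inverse c"] absval_eq_0_iff[of "inverse c"] False by simp
  ultimately show ?thesis
    using le[of c] by simp
qed (simp add: zero absval_zero)

lemma sum_le: "W (\<Sum>i\<in>I. f i) \<le> (\<Sum>i\<in>I. W (f i))"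
  by (induction I rule: infinite_finite_induct)
    (auto simp: zero intro: order_trans[OF add])

text \<open>Expand \<open>(p + q)\<^sup>n\<close>: the binomial coefficients have absolute value at most 1, so
  \<open>W (p + q)\<^sup>n\<close> is bounded by \<open>n + 1\<close> times the \<open>n\<close>-th power of the maximum.\<close>

lemma ultrametric: "W (p + q) \<le> max (W p) (W q)"
proof (rule le_if_power_le_linear_times_power)
  show "0 \<le> max (W p) (W q)"
    using nonneg[of p] by simp
  fix n
  have "W (p + q) ^ n = W (\<Sum>k\<le>n. of_nat (n choose k) * p ^ k * q ^ (n - k))"
    by (simp add: power[symmetric] binomial_ring)
  also have "\<dots> \<le> (\<Sum>k\<le>n. W (of_nat (n choose k) * p ^ k * q ^ (n - k)))"
    by (rule sum_le)
  also have "\<dots> \<le> (\<Sum>k\<le>n. max (W p) (W q) ^ n)"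
  proof (rule sum_mono)
    fix k assume "k \<in> {..n}"
    have "W (of_nat (n choose k)) \<le> 1"
      by (simp add: of_nat_poly const absval_of_nat_le_one)
    moreover have "W p ^ k \<le> max (W p) (W q) ^ k" "W q ^ (n - k) \<le> max (W p) (W q) ^ (n - k)"
      by (simp_all add: power_mono nonneg)
    ultimately have "W (of_nat (n choose k)) * W p ^ k * W q ^ (n - k)
        \<le> 1 * max (W p) (W q) ^ k * max (W p) (W q) ^ (n - k)"
      using nonneg[of p] nonneg[of q] nonneg[of "of_nat (n choose k)"]
      by (intro mult_mono) auto
    also have "\<dots> = max (W p) (W q) ^ n"
      using \<open>k \<in> {..n}\<close> by (simp flip: power_add)
    finally show "W (of_nat (n choose k) * p ^ k * q ^ (n - k)) \<le> max (W p) (W q) ^ n"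
      by (simp add: mult power)
  qed
  finally show "W (p + q) ^ n \<le> 1 * (real n + 1) * max (W p) (W q) ^ n"
    by (simp add: algebra_simps)
qed (rule nonneg)

lemma minus: "W (- p) = W p"
  using mult[of "[:- 1:]" p] const[of "- 1"] by (simp add: absval_minus absval_one)

text \<open>The constant \<open>z - y\<close> is the difference of \<open>X - y\<close> and \<open>X - z\<close>.\<close>

lemma dist_le_max_linear: "dist y z \<le> max (W [:- y, 1:]) (W [:- z, 1:])"
  using ultrametric[of "[:- z, 1:]" "- [:- y, 1:]"]
  by (simp only: minus) (simp add: const dist_absval)

text \<open>Centres are added in the order of increasing \<open>W (X - z)\<close>. Let \<open>s = W (X - z)\<close> for the new
  centre \<open>z\<close>. On the older balls \<open>X - z\<close> is at most \<open>s\<close>, by \<open>dist_le_max_linear\<close> and the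
  ultrametric inequality, so a factor \<open>(X - z)\<^sup>M\<close> preserves the estimate there. On the new ball
  \<open>X - z\<close> is at most \<open>s / 2\<close>, so a large \<open>M\<close> outweighs any bound of the old polynomial.\<close>

lemma exists_small_on_balls:
  assumes "finite F" "F \<subseteq> S" and pos: "\<And>z. z \<in> S \<Longrightarrow> 0 < W [:- z, 1:]"
  shows "\<exists>p. 0 < W p \<and> (\<forall>w\<in>S. (\<exists>z\<in>F. dist z w < W [:- z, 1:] / 2) \<longrightarrow> absval (poly p w) \<le> W p / 2)"
  using assms(1,2)
proof (induction F rule: finite_ranking_induct[where f = "\<lambda>z. W [:- z, 1:]"])
  case empty
  show ?case by (rule exI[of _ 1]) (simp add: one)
next
  case (insert z F)
  let ?s = "W [:- z, 1:]"
  obtain p where p: "0 < W p"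
    "\<And>w y. w \<in> S \<Longrightarrow> y \<in> F \<Longrightarrow> dist y w < W [:- y, 1:] / 2 \<Longrightarrow> absval (poly p w) \<le> W p / 2"
    using insert.IH insert.prems by (metis insert_subset)
  have s: "0 < ?s"
    using pos insert.prems by simp
  obtain B where B: "\<And>w. w \<in> S \<Longrightarrow> absval (poly p w) \<le> B"
  proof -
    have "compact ((\<lambda>w. absval (poly p w)) ` S)"
      by (intro compact_continuous_image continuous_on_absval continuous_on_poly continuous_on_id compact)
    then show ?thesis
      using that by (meson bdd_above.E bounded_imp_bdd_above compact_imp_bounded image_eqI)
  qed
  \<comment> \<open>The exponent that makes \<open>absval p\<close>, bounded by \<open>B\<close> on \<open>S\<close>, irrelevant on the new ball.\<close>
  obtain M where M: "B * (1 / 2) ^ M \<le> W p / 2"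
  proof -
    have "(\<lambda>M. B * (1 / 2) ^ M) \<longlonglongrightarrow> B * 0"
      by (intro tendsto_intros LIMSEQ_power_zero) simp
    then have "eventually (\<lambda>M. B * (1 / 2) ^ M < W p / 2) sequentially"
      using p(1) by (intro order_tendstoD) auto
    then show ?thesis
      using that eventually_happens'[OF sequentially_bot] less_imp_le by blast
  qed
  define q where "q = p * [:- z, 1:] ^ M"
  have Wq: "W q = W p * ?s ^ M"
    by (simp add: q_def mult power)
  have absq: "absval (poly q w) = absval (poly p w) * dist z w ^ M" for w
    using dist_commute[of z w] by (simp add: q_def absval_mult absval_power dist_absval)
  have "absval (poly q w) \<le> W q / 2"
    if w: "w \<in> S" and y: "y \<in> insert z F" "dist y w < W [:- y, 1:] / 2" for w y
  proof (cases "y = z")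
    case True
    have "absval (poly q w) \<le> B * (?s / 2) ^ M"
      unfolding absq using B[OF w] y True absval_nonneg[of "poly p w"]
      by (intro mult_mono power_mono) auto
    also have "\<dots> = B * (1 / 2) ^ M * ?s ^ M"
      by (simp add: power_divide)
    also have "\<dots> \<le> W p / 2 * ?s ^ M"
      using M s by (intro mult_right_mono) auto
    finally show ?thesis by (simp add: Wq)
  next
    case False
    then have yF: "y \<in> F" using y by simp
    have le: "W [:- y, 1:] \<le> ?s"
      using insert yF by blast
    have "dist z w \<le> max (dist z y) (dist y w)"
      by (rule dist_ultrametric)
    also have "\<dots> \<le> ?s"
      using dist_le_max_linear[of z y] le y s by simp
    finally have "absval (poly q w) \<le> W p / 2 * ?s ^ M"
      unfolding absq using p(1) by (intro mult_mono p(2)[OF w yF y(2)] power_mono) auto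
    then show ?thesis by (simp add: Wq)
  qed
  then show ?case
    using p(1) s by (intro exI[of _ q]) (auto simp: Wq)
qed

text \<open>Otherwise the balls of radius \<open>W (X - z) / 2\<close> cover \<open>S\<close>, and \<open>exists_small_on_balls\<close> yields
  a polynomial with \<open>\<bar>p\<bar> \<le> W p / 2 < W p\<close> on \<open>S\<close>, against \<open>le_sup\<close>.\<close>

lemma exists_linear_eq_0: "\<exists>z\<in>S. W [:- z, 1:] = 0"
proof (rule ccontr)
  assume "\<not> ?thesis"
  then have pos: "0 < W [:- z, 1:]" if "z \<in> S" for z
    using nonneg[of "[:- z, 1:]"] that by (auto simp: less_le)
  obtain F where F: "F \<subseteq> S" "finite F" "S \<subseteq> (\<Union>z\<in>F. ball z (W [:- z, 1:] / 2))"
    by (rule compactE_image[OF compact, of S "\<lambda>z. ball z (W [:- z, 1:] / 2)"]) (use pos in auto)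
  obtain p where "0 < W p"
    "\<forall>w\<in>S. (\<exists>z\<in>F. dist z w < W [:- z, 1:] / 2) \<longrightarrow> absval (poly p w) \<le> W p / 2"
    using exists_small_on_balls[OF F(2,1) pos] by blast
  moreover have "\<exists>z\<in>F. dist z w < W [:- z, 1:] / 2" if "w \<in> S" for w
    using F(3) that by (meson UN_E mem_ball subsetD)
  ultimately show False
    using le_sup[of p "W p / 2"] by fastforce
qed

lemma eq_absval_evaluation: "\<exists>z\<in>S. \<forall>p. W p = absval (poly p z)"
proof -
  obtain z where z: "z \<in> S" "W [:- z, 1:] = 0"
    using exists_linear_eq_0 by blast
  have "W p = absval (poly p z)" for p
  proof -
    have "[:- z, 1:] dvd p - [:poly p z:]"
      by (simp flip: poly_eq_0_iff_dvd)
    then obtain q where "p - [:poly p z:] = [:- z, 1:] * q"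
      by (elim dvdE)
    then have "W (p - [:poly p z:]) = 0"
      by (simp only: mult) (simp add: z)
    then show ?thesis
      using add[of "p - [:poly p z:]" "[:poly p z:]"] add[of "- (p - [:poly p z:])" p] minus[of "p - [:poly p z:]"]
      by (simp add: const)
  qed
  then show ?thesis
    using z by blast
qed

end

section \<open>Residue fields of scalar-valued points\<close>

text \<open>Residue rings, fraction fields and completions are built from classes of representatives. An
  isomorphism \<open>E\<close> from the valued field \<open>K\<close> names each class by an element of \<open>K\<close>, which turns
  computations with representatives into computations in \<open>K\<close>.\<close>

locale field_copy =
  fixes D :: "'d ring" and E :: "'k::nonarch_valued_field \<Rightarrow> 'd" and v :: "'d \<Rightarrow> real"
  assumes carrier: "carrier D = range E"
    and inj: "inj E"
    and zero: "\<zero>\<^bsub>D\<^esub> = E 0"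
    and one: "\<one>\<^bsub>D\<^esub> = E 1"
    and add: "E c \<oplus>\<^bsub>D\<^esub> E d = E (c + d)"
    and mult: "E c \<otimes>\<^bsub>D\<^esub> E d = E (c * d)"
    and absval: "v (E c) = absval c"
begin

lemma eq_iff [simp]: "E c = E d \<longleftrightarrow> c = d"
  using inj by (simp add: inj_eq)

lemma minus: "E c \<ominus>\<^bsub>D\<^esub> E d = E (c - d)"
proof -
  have "\<ominus>\<^bsub>D\<^esub> E d = E (- d)"
    unfolding a_inv_def m_inv_def
    by (rule the_equality) (auto simp: carrier zero add add_eq_0_iff)
  then show ?thesis
    by (simp add: a_minus_def add)
qed

lemma fraction_eq:
  assumes "b \<noteq> 0"
  shows "fraction D (E a) (E b) = {(E c, E d) | c d. d \<noteq> 0 \<and> c / d = a / b}"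
proof -
  have "fraction D (E a) (E b) = {(E c, E d) | c d. d \<noteq> 0 \<and> a * d = c * b}"
    using assms by (auto simp: fraction_def fraction_rel_def carrier zero mult)
  moreover have "a * d = c * b \<longleftrightarrow> c / d = a / b" if "d \<noteq> 0" for c d
    using frac_eq_eq[OF that assms, of c a] by auto
  ultimately show ?thesis by auto
qed

lemma fraction_eq_quotient:
  "b \<noteq> 0 \<Longrightarrow> fraction D (E a) (E b) = fraction D (E (a / b)) (E 1)"
  by (simp add: fraction_eq)

text \<open>A field is its own fraction field: the class of \<open>(E a, E b)\<close> is that of \<open>(E (a / b), 1)\<close>, so
  every representative of a class gives the same sum, product and absolute value.\<close>

lemma fraction_field: "field_copy (fraction_field D) (\<lambda>c. fraction D (E c) \<one>\<^bsub>D\<^esub>) (fraction_absval v)"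
proof
  show "carrier (fraction_field D) = range (\<lambda>c. fraction D (E c) \<one>\<^bsub>D\<^esub>)"
  proof -
    have "range E \<times> (range E - {E 0}) = (\<lambda>(a, b). (E a, E b)) ` (UNIV \<times> - {0})"
    proof (intro equalityI subsetI)
      fix p assume "p \<in> range E \<times> (range E - {E 0})"
      then obtain a b where "p = (E a, E b)" "b \<noteq> 0" by auto
      then show "p \<in> (\<lambda>(a, b). (E a, E b)) ` (UNIV \<times> - {0})"
        by (intro image_eqI[of _ _ "(a, b)"]) auto
    qed auto
    then have "carrier (fraction_field D) = (\<lambda>(a, b). fraction D (E a) (E b)) ` (UNIV \<times> - {0})"
      by (simp add: fraction_field_def carrier zero quotient_def fraction_def
          UNION_singleton_eq_range image_image case_prod_unfold)
    also have "\<dots> = range (\<lambda>c. fraction D (E c) \<one>\<^bsub>D\<^esub>)"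
    proof (intro equalityI subsetI)
      fix X assume "X \<in> (\<lambda>(a, b). fraction D (E a) (E b)) ` (UNIV \<times> - {0})"
      then obtain a b where "b \<noteq> 0" "X = fraction D (E a) (E b)" by auto
      then show "X \<in> range (\<lambda>c. fraction D (E c) \<one>\<^bsub>D\<^esub>)"
        using fraction_eq_quotient[of b a] by (simp add: one)
    next
      fix X assume "X \<in> range (\<lambda>c. fraction D (E c) \<one>\<^bsub>D\<^esub>)"
      then obtain c where "X = fraction D (E c) (E 1)" by (auto simp: one)
      then show "X \<in> (\<lambda>(a, b). fraction D (E a) (E b)) ` (UNIV \<times> - {0})"
        by (intro image_eqI[of _ _ "(c, 1)"]) auto
    qed
    finally show ?thesis .
  qed
  show "inj (\<lambda>c. fraction D (E c) \<one>\<^bsub>D\<^esub>)"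
  proof (rule injI)
    fix c d
    assume *: "fraction D (E c) \<one>\<^bsub>D\<^esub> = fraction D (E d) \<one>\<^bsub>D\<^esub>"
    have "(E c, E 1) \<in> fraction D (E c) \<one>\<^bsub>D\<^esub>"
      by (auto simp: one fraction_eq)
    then show "c = d"
      unfolding * by (auto simp: one fraction_eq)
  qed
  show "\<zero>\<^bsub>fraction_field D\<^esub> = fraction D (E 0) \<one>\<^bsub>D\<^esub>"
    by (simp add: fraction_field_def zero)
  show "\<one>\<^bsub>fraction_field D\<^esub> = fraction D (E 1) \<one>\<^bsub>D\<^esub>"
    by (simp add: fraction_field_def one)
next
  fix c d
  let ?X = "fraction D (E c) \<one>\<^bsub>D\<^esub>" and ?Y = "fraction D (E d) \<one>\<^bsub>D\<^esub>"
  have X: "?X = {(E a, E b) | a b. b \<noteq> 0 \<and> a / b = c}" and Y: "?Y = {(E a, E b) | a b. b \<noteq> 0 \<and> a / b = d}"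
    by (auto simp: one fraction_eq)
  have mem: "(E c, E 1) \<in> ?X" "(E d, E 1) \<in> ?Y"
    by (auto simp: X Y)
  have "(\<Union>(a, b)\<in>?X. \<Union>(c, d)\<in>?Y. fraction D (a \<otimes>\<^bsub>D\<^esub> d \<oplus>\<^bsub>D\<^esub> c \<otimes>\<^bsub>D\<^esub> b) (b \<otimes>\<^bsub>D\<^esub> d))
      = fraction D (E (c + d)) \<one>\<^bsub>D\<^esub>" (is "?L = _")
  proof -
    have "(case p of (a, b) \<Rightarrow> \<Union>(c, d)\<in>?Y. fraction D (a \<otimes>\<^bsub>D\<^esub> d \<oplus>\<^bsub>D\<^esub> c \<otimes>\<^bsub>D\<^esub> b) (b \<otimes>\<^bsub>D\<^esub> d))
        = fraction D (E (c + d)) \<one>\<^bsub>D\<^esub>" if "p \<in> ?X" for p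
    proof -
      from that obtain a b where p: "p = (E a, E b)" "b \<noteq> 0" "a / b = c"
        unfolding X by blast
      have "(case q of (c, d) \<Rightarrow> fraction D (E a \<otimes>\<^bsub>D\<^esub> d \<oplus>\<^bsub>D\<^esub> c \<otimes>\<^bsub>D\<^esub> E b) (E b \<otimes>\<^bsub>D\<^esub> d))
         = fraction D (E (c + d)) \<one>\<^bsub>D\<^esub>" if "q \<in> ?Y" for q
      proof -
        from that obtain a' b' where q: "q = (E a', E b')" "b' \<noteq> 0" "a' / b' = d"
          unfolding Y by blast
        have "(a * b' + a' * b) / (b * b') = c + d"
          using p q by (auto simp: field_simps)
        then show ?thesis
          using p(2) q(2) by (simp add: q(1) mult add one fraction_eq_quotient[of "b * b'"])
      qed
      then show ?thesis
        using mem(2) unfolding p(1) by auto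
    qed
    then show ?thesis
      using mem(1) by blast
  qed
  then show "?X \<oplus>\<^bsub>fraction_field D\<^esub> ?Y = fraction D (E (c + d)) \<one>\<^bsub>D\<^esub>"
    by (simp add: fraction_field_def)
  have "(\<Union>(a, b)\<in>?X. \<Union>(c, d)\<in>?Y. fraction D (a \<otimes>\<^bsub>D\<^esub> c) (b \<otimes>\<^bsub>D\<^esub> d)) = fraction D (E (c * d)) \<one>\<^bsub>D\<^esub>"
  proof -
    have "(case p of (a, b) \<Rightarrow> \<Union>(c, d)\<in>?Y. fraction D (a \<otimes>\<^bsub>D\<^esub> c) (b \<otimes>\<^bsub>D\<^esub> d))
        = fraction D (E (c * d)) \<one>\<^bsub>D\<^esub>" if "p \<in> ?X" for p
    proof -
      from that obtain a b where p: "p = (E a, E b)" "b \<noteq> 0" "a / b = c"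
        unfolding X by blast
      have "(case q of (c, d) \<Rightarrow> fraction D (E a \<otimes>\<^bsub>D\<^esub> c) (E b \<otimes>\<^bsub>D\<^esub> d))
         = fraction D (E (c * d)) \<one>\<^bsub>D\<^esub>" if "q \<in> ?Y" for q
      proof -
        from that obtain a' b' where q: "q = (E a', E b')" "b' \<noteq> 0" "a' / b' = d"
          unfolding Y by blast
        have "(a * a') / (b * b') = c * d"
          using p q by auto
        then show ?thesis
          using p(2) q(2) by (simp add: q(1) mult one fraction_eq_quotient[of "b * b'"])
      qed
      then show ?thesis
        using mem(2) unfolding p(1) by auto
    qed
    then show ?thesis
      using mem(1) by blast
  qed
  then show "?X \<otimes>\<^bsub>fraction_field D\<^esub> ?Y = fraction D (E (c * d)) \<one>\<^bsub>D\<^esub>"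
    by (simp add: fraction_field_def)
  show "fraction_absval v ?X = absval c"
    unfolding fraction_absval_def
  proof (rule the_equality)
    show "\<exists>(a, b)\<in>?X. absval c = v a / v b"
      using mem(1) by (rule rev_bexI) (simp add: absval absval_one)
  next
    fix r assume "\<exists>(a, b)\<in>?X. r = v a / v b"
    then obtain a b where ab: "b \<noteq> 0" "a / b = c" "r = v (E a) / v (E b)"
      unfolding X by blast
    then have "a = c * b" by auto
    then show "r = absval c"
      using ab(1,3) by (simp add: absval absval_mult absval_eq_0_iff)
  qed
qed

lemma cauchy_carrier: "carrier (cauchy_ring D v) = {\<lambda>n. E (s n) | s. Cauchy s}"
proof -
  have "(range f \<subseteq> range E) \<longleftrightarrow> (\<exists>s. f = (\<lambda>n. E (s n)))" for f :: "nat \<Rightarrow> 'd"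
  proof
    assume "range f \<subseteq> range E"
    then have "\<forall>n. \<exists>c. f n = E c" by blast
    then show "\<exists>s. f = (\<lambda>n. E (s n))" by metis
  qed auto
  then have "f \<in> carrier (cauchy_ring D v) \<longleftrightarrow> (\<exists>s. f = (\<lambda>n. E (s n)) \<and> Cauchy s)" for f
    by (auto simp: cauchy_ring_def carrier minus absval Cauchy_def dist_absval)
  then show ?thesis by blast
qed

lemma null_sequences_eq: "null_sequences D v = {\<lambda>n. E (s n) | s. s \<longlonglongrightarrow> 0}"
proof -
  have "(\<lambda>n. v (E (s n))) \<longlonglongrightarrow> 0 \<longleftrightarrow> s \<longlonglongrightarrow> 0" for s
    unfolding tendsto_dist_iff[of s] by (simp add: absval dist_absval)
  then show ?thesis
    unfolding null_sequences_def cauchy_carrier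
    by (auto intro: LIMSEQ_imp_Cauchy)
qed

lemma null_coset:
  assumes "s \<longlonglongrightarrow> c"
  shows "null_sequences D v +>\<^bsub>cauchy_ring D v\<^esub> (\<lambda>n. E (s n)) = {\<lambda>n. E (t n) | t. t \<longlonglongrightarrow> c}"
proof -
  have "(\<lambda>n. E (u n)) \<oplus>\<^bsub>cauchy_ring D v\<^esub> (\<lambda>n. E (s n)) = (\<lambda>n. E (u n + s n))" for u
    by (simp add: cauchy_ring_def add)
  then have "null_sequences D v +>\<^bsub>cauchy_ring D v\<^esub> (\<lambda>n. E (s n)) =
      {\<lambda>n. E (u n + s n) | u. u \<longlonglongrightarrow> 0}"
    unfolding a_r_coset_def' null_sequences_eq by auto
  also have "\<dots> = {\<lambda>n. E (t n) | t. t \<longlonglongrightarrow> c}"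
  proof (intro equalityI subsetI)
    fix f assume "f \<in> {\<lambda>n. E (u n + s n) | u. u \<longlonglongrightarrow> 0}"
    then obtain u where "f = (\<lambda>n. E (u n + s n))" "u \<longlonglongrightarrow> 0" by blast
    then show "f \<in> {\<lambda>n. E (t n) | t. t \<longlonglongrightarrow> c}"
      using tendsto_add[of u 0 _ s c] assms by (intro CollectI exI[of _ "\<lambda>n. u n + s n"]) simp
  next
    fix f assume "f \<in> {\<lambda>n. E (t n) | t. t \<longlonglongrightarrow> c}"
    then obtain t where "f = (\<lambda>n. E (t n))" "t \<longlonglongrightarrow> c" by blast
    then show "f \<in> {\<lambda>n. E (u n + s n) | u. u \<longlonglongrightarrow> 0}"
      using tendsto_diff[of t c _ s c] assms by (intro CollectI exI[of _ "\<lambda>n. t n - s n"]) simp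
  qed
  finally show ?thesis .
qed

text \<open>Each Cauchy sequence of the complete field \<open>K\<close> is its limit plus a null sequence, so the constant
  sequences represent all classes.\<close>

lemma completion_carrier:
  assumes "\<And>s :: nat \<Rightarrow> 'k. Cauchy s \<Longrightarrow> convergent s"
  shows "carrier (field_completion D v) =
    range (\<lambda>c. null_sequences D v +>\<^bsub>cauchy_ring D v\<^esub> (\<lambda>n. E c))"
proof -
  have "carrier (field_completion D v) =
    {null_sequences D v +>\<^bsub>cauchy_ring D v\<^esub> (\<lambda>n. E (s n)) | s. Cauchy s}"
    by (auto simp: field_completion_def FactRing_def A_RCOSETS_def' cauchy_carrier)
  also have "\<dots> = range (\<lambda>c. {\<lambda>n. E (t n) | t. t \<longlonglongrightarrow> c})"
  proof (intro equalityI subsetI)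
    fix X assume "X \<in> {null_sequences D v +>\<^bsub>cauchy_ring D v\<^esub> (\<lambda>n. E (s n)) | s. Cauchy s}"
    then obtain s where s: "X = null_sequences D v +>\<^bsub>cauchy_ring D v\<^esub> (\<lambda>n. E (s n))" "Cauchy s"
      by blast
    then obtain c where "s \<longlonglongrightarrow> c"
      using assms by (auto simp: convergent_def)
    then show "X \<in> range (\<lambda>c. {\<lambda>n. E (t n) | t. t \<longlonglongrightarrow> c})"
      using null_coset s by blast
  next
    fix X assume "X \<in> range (\<lambda>c. {\<lambda>n. E (t n) | t. t \<longlonglongrightarrow> c})"
    then obtain c where "X = null_sequences D v +>\<^bsub>cauchy_ring D v\<^esub> (\<lambda>n. E c)"
      using null_coset[OF tendsto_const] by auto
    moreover have "Cauchy (\<lambda>n. c)"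
      by (rule LIMSEQ_imp_Cauchy[OF tendsto_const])
    ultimately show "X \<in> {null_sequences D v +>\<^bsub>cauchy_ring D v\<^esub> (\<lambda>n. E (s n)) | s. Cauchy s}"
      by (intro CollectI exI[of _ "\<lambda>n. c"]) simp
  qed
  finally show ?thesis
    by (simp add: null_coset[OF tendsto_const])
qed

lemma const_coset_inject:
  assumes "null_sequences D v +>\<^bsub>cauchy_ring D v\<^esub> (\<lambda>n. E c) = null_sequences D v +>\<^bsub>cauchy_ring D v\<^esub> (\<lambda>n. E d)"
  shows "c = d"
proof -
  have "(\<lambda>n. E c) \<in> {\<lambda>n. E (t n) | t. t \<longlonglongrightarrow> c}"
    by (auto intro!: exI[of _ "\<lambda>n. c"])
  then have "(\<lambda>n. E c) \<in> {\<lambda>n. E (t n) | t. t \<longlonglongrightarrow> d}"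
    using assms by (simp only: null_coset[OF tendsto_const])
  then obtain t where t: "(\<lambda>n. E c) = (\<lambda>n. E (t n))" "t \<longlonglongrightarrow> d"
    by blast
  have "t = (\<lambda>n. c)"
    using t(1) by (simp add: fun_eq_iff)
  then show ?thesis
    using t(2) by (simp add: LIMSEQ_const_iff)
qed

end

text \<open>Such a seminorm \<open>x\<close> has the same kernel as \<open>\<phi>\<close>, so its residue ring is \<open>K\<close>, which is already a
  complete field. The section \<open>\<iota>\<close> of \<open>\<phi>\<close> picks a representative of each residue class.\<close>

locale scalar_valued_point = ring R for R :: "'r ring" (structure) +
  fixes \<phi> :: "'r \<Rightarrow> 'k::{nonarch_valued_field, complete_space}" and \<iota> :: "'k \<Rightarrow> 'r" and x :: "'r \<Rightarrow> real"
  assumes phi_add: "f \<in> carrier R \<Longrightarrow> g \<in> carrier R \<Longrightarrow> \<phi> (f \<oplus> g) = \<phi> f + \<phi> g"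
    and phi_mult: "f \<in> carrier R \<Longrightarrow> g \<in> carrier R \<Longrightarrow> \<phi> (f \<otimes> g) = \<phi> f * \<phi> g"
    and phi_one: "\<phi> \<one> = 1"
    and iota_closed: "\<iota> c \<in> carrier R"
    and phi_iota: "\<phi> (\<iota> c) = c"
    and seminorm_eq: "f \<in> carrier R \<Longrightarrow> x f = absval (\<phi> f)"
begin

definition fibre :: "'k \<Rightarrow> 'r set" where
  "fibre c = {f \<in> carrier R. \<phi> f = c}"

lemma phi_minus:
  assumes "f \<in> carrier R" "g \<in> carrier R" shows "\<phi> (f \<ominus> g) = \<phi> f - \<phi> g"
proof -
  have "\<phi> ((f \<ominus> g) \<oplus> g) = \<phi> (f \<ominus> g) + \<phi> g"
    using assms by (intro phi_add) auto
  moreover have "(f \<ominus> g) \<oplus> g = f"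
    using assms by (simp add: a_minus_def a_assoc l_neg)
  ultimately show ?thesis by simp
qed

lemma decompose: "f \<in> carrier R \<Longrightarrow> g \<in> carrier R \<Longrightarrow> (f \<ominus> g) \<oplus> g = f"
  by (simp add: a_minus_def a_assoc l_neg)

lemma kernel_eq: "seminorm_kernel R x = fibre 0"
  by (auto simp: seminorm_kernel_def fibre_def seminorm_eq absval_eq_0_iff)

lemma kernel_coset:
  assumes "f \<in> carrier R"
  shows "seminorm_kernel R x +> f = fibre (\<phi> f)"
proof (intro equalityI subsetI)
  fix g assume "g \<in> fibre (\<phi> f)"
  then have "g \<in> carrier R" "\<phi> g = \<phi> f" by (auto simp: fibre_def)
  then show "g \<in> seminorm_kernel R x +> f"
    unfolding a_r_coset_def' kernel_eq using assms
    by (auto simp: fibre_def phi_minus intro!: bexI[of _ "g \<ominus> f"] sym[OF decompose])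
qed (use assms in \<open>auto simp: a_r_coset_def' kernel_eq fibre_def phi_add\<close>)

lemma iota_in_fibre: "\<iota> c \<in> fibre c"
  by (simp add: fibre_def iota_closed phi_iota)

text \<open>The cosets of the kernel of \<open>x\<close> are the fibres of \<open>\<phi>\<close>, which are indexed by \<open>K\<close>. That the sum
  of two fibres is a whole fibre uses subtraction in \<open>R\<close>.\<close>

lemma residue_domain: "field_copy (residue_domain R x) fibre (residue_absval x)"
proof
  show "carrier (residue_domain R x) = range fibre"
  proof -
    have "carrier (residue_domain R x) = (\<lambda>f. fibre (\<phi> f)) ` carrier R"
      by (auto simp: residue_domain_def FactRing_def A_RCOSETS_def' kernel_coset)
    moreover have "\<phi> ` carrier R = UNIV"
      using phi_iota iota_closed by (metis image_eqI surjI surj_def UNIV_eq_I)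
    ultimately show ?thesis
      by (metis image_image)
  qed
  show "inj fibre"
  proof (rule injI)
    fix c d assume "fibre c = fibre d"
    then show "c = d"
      using iota_in_fibre[of c] by (simp add: fibre_def phi_iota)
  qed
  show "\<zero>\<^bsub>residue_domain R x\<^esub> = fibre 0"
    by (simp add: residue_domain_def FactRing_def kernel_eq)
  show "\<one>\<^bsub>residue_domain R x\<^esub> = fibre 1"
    by (simp add: residue_domain_def FactRing_def kernel_coset phi_one)
next
  fix c d
  show "fibre c \<oplus>\<^bsub>residue_domain R x\<^esub> fibre d = fibre (c + d)"
  proof -
    have "\<exists>g\<in>fibre c. \<exists>h\<in>fibre d. f = g \<oplus> h" if "f \<in> fibre (c + d)" for f
      using that iota_in_fibre[of d] phi_minus[of f "\<iota> d"]
      by (intro bexI[of _ "f \<ominus> \<iota> d"] bexI[of _ "\<iota> d"]) (auto simp: fibre_def decompose)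
    then show ?thesis
      by (auto simp: residue_domain_def FactRing_def set_add_def' fibre_def phi_add)
  qed
  have "(\<Union>f\<in>fibre c. \<Union>g\<in>fibre d. seminorm_kernel R x +> (f \<otimes> g))
      = (\<Union>f\<in>fibre c. \<Union>g\<in>fibre d. fibre (c * d))"
    by (intro SUP_cong refl) (auto simp: fibre_def kernel_coset phi_mult)
  also have "\<dots> = fibre (c * d)"
    using iota_in_fibre by auto
  finally show "fibre c \<otimes>\<^bsub>residue_domain R x\<^esub> fibre d = fibre (c * d)"
    by (simp add: residue_domain_def FactRing_def rcoset_mult_def)
  show "residue_absval x (fibre c) = absval c"
    unfolding residue_absval_def
    by (rule the_equality) (use iota_in_fibre in \<open>auto simp: fibre_def seminorm_eq\<close>)
qed

lemma character_eq:
  "f \<in> carrier R \<Longrightarrow> berkovich_character R x f = berkovich_character R x (\<iota> (\<phi> f))"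
  by (simp add: berkovich_character_def kernel_coset iota_closed phi_iota)

lemma character_iota_inject:
  assumes "berkovich_character R x (\<iota> c) = berkovich_character R x (\<iota> d)"
  shows "c = d"
  using field_copy.const_coset_inject[OF field_copy.fraction_field[OF residue_domain]] assms
  by (simp add: berkovich_character_def kernel_coset iota_closed phi_iota Let_def)

lemma completed_residue_field_eq:
  "carrier (completed_residue_field R x) = range (\<lambda>c. berkovich_character R x (\<iota> c))"
  using field_copy.completion_carrier[OF field_copy.fraction_field[OF residue_domain]]
  by (simp add: berkovich_character_def completed_residue_field_def kernel_coset iota_closed phi_iota Let_def
     Cauchy_convergent_iff)

end

section \<open>The Banach space of continuous functions\<close>

lift_definition cfun_const :: "'k::nonarch_valued_field \<Rightarrow> ('m::topological_space, 'k) cfun"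
  is "\<lambda>c _. c" by simp

lift_definition cfun_poly :: "'k::nonarch_valued_field poly \<Rightarrow> ('m::topological_space, 'k) cfun \<Rightarrow> ('m, 'k) cfun"
  is "\<lambda>p f m. poly p (f m)" by (rule continuous_on_poly)

lemma cfun_eqI: "(\<And>m. cfun_apply f m = cfun_apply g m) \<Longrightarrow> f = g"
  by transfer auto

lemmas cfun_apply_simps [simp] =
  zero_cfun.rep_eq plus_cfun.rep_eq uminus_cfun.rep_eq minus_cfun.rep_eq
  cfun_scale.rep_eq cfun_mult.rep_eq cfun_const.rep_eq cfun_poly.rep_eq

lemma continuous_cfun_apply: "continuous_on S (cfun_apply f)"
  using cfun_apply[of f] continuous_on_subset by blast

lemma cfun_norm_le: "(\<And>m. absval (cfun_apply f m) \<le> B) \<Longrightarrow> cfun_norm f \<le> B"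
  unfolding cfun_norm_def by (rule cSUP_least) auto

lemma cfun_norm_const: "cfun_norm (cfun_const c) = absval c"
  by (simp add: cfun_norm_def)

lemma cfun_mult_one: "cfun_mult f (cfun_const 1) = f"
  by (rule cfun_eqI) simp

lemma vector_space_cfun: "vector_space cfun_scale"
  by unfold_locales (auto intro!: cfun_eqI simp: algebra_simps)

context
  assumes compact: "compact (UNIV :: 'm::topological_space set)"
begin

lemma absval_le_cfun_norm: "absval (cfun_apply f m) \<le> cfun_norm (f :: ('m, 'k::nonarch_valued_field) cfun)"
proof -
  have "compact (range (\<lambda>m. absval (cfun_apply f m)))"
    by (intro compact_continuous_image continuous_on_absval continuous_cfun_apply compact)
  then show ?thesis
    unfolding cfun_norm_def
    by (intro cSUP_upper bounded_imp_bdd_above compact_imp_bounded) auto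
qed

lemma cfun_norm_nonneg: "0 \<le> cfun_norm (f :: ('m, 'k::nonarch_valued_field) cfun)"
  using absval_le_cfun_norm[of f undefined] absval_nonneg order_trans by blast

lemma cfun_norm_eq_0_iff: "cfun_norm (f :: ('m, 'k::nonarch_valued_field) cfun) = 0 \<longleftrightarrow> f = 0"
proof
  assume "cfun_norm f = 0"
  then have "absval (cfun_apply f m) = 0" for m
    using absval_le_cfun_norm[of f m] absval_nonneg[of "cfun_apply f m"] by simp
  then show "f = 0"
    by (intro cfun_eqI) (simp add: absval_eq_0_iff)
qed (simp add: cfun_norm_def absval_zero)

lemma cfun_norm_mult_le:
  "cfun_norm (cfun_mult f g) \<le> cfun_norm f * cfun_norm (g :: ('m, 'k::nonarch_valued_field) cfun)"
  by (rule cfun_norm_le)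
     (auto simp: absval_mult intro!: mult_mono absval_le_cfun_norm absval_nonneg cfun_norm_nonneg)

lemma cfun_norm_scale:
  "cfun_norm (cfun_scale c f) = absval c * cfun_norm (f :: ('m, 'k::nonarch_valued_field) cfun)"
proof (rule antisym)
  show le: "cfun_norm (cfun_scale c f) \<le> absval c * cfun_norm f"
    by (rule cfun_norm_le) (auto simp: absval_mult intro!: mult_left_mono absval_le_cfun_norm absval_nonneg)
  show "absval c * cfun_norm f \<le> cfun_norm (cfun_scale c f)"
  proof (cases "c = 0")
    case False
    then have pos: "0 < absval c"
      using absval_nonneg[of c] absval_eq_0_iff[of c] by simp
    have "cfun_norm f \<le> cfun_norm (cfun_scale c f) / absval c"
    proof (rule cfun_norm_le)
      fix m
      show "absval (cfun_apply f m) \<le> cfun_norm (cfun_scale c f) / absval c"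
        using absval_le_cfun_norm[of "cfun_scale c f" m] pos
        by (simp add: absval_mult field_simps)
    qed
    then show ?thesis
      using pos by (simp add: field_simps)
  qed (simp add: absval_zero cfun_norm_nonneg)
qed

lemma cfun_norm_ultrametric:
  "cfun_norm (f + g) \<le> max (cfun_norm f) (cfun_norm (g :: ('m, 'k::nonarch_valued_field) cfun))"
proof (rule cfun_norm_le)
  fix m
  show "absval (cfun_apply (f + g) m) \<le> max (cfun_norm f) (cfun_norm g)"
    using absval_ultrametric[of "cfun_apply f m" "cfun_apply g m"]
      absval_le_cfun_norm[of f m] absval_le_cfun_norm[of g m] by auto
qed

text \<open>Cauchy sequences in the supremum norm are uniformly Cauchy, and uniform limits of continuous functions
  are continuous.\<close>

lemma cfun_complete:
  fixes s :: "nat \<Rightarrow> ('m, 'k::{nonarch_valued_field, complete_space}) cfun"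
  assumes "\<forall>\<epsilon>>0. \<exists>n0. \<forall>m\<ge>n0. \<forall>n\<ge>n0. cfun_norm (s m - s n) < \<epsilon>"
  shows "\<exists>l. (\<lambda>n. cfun_norm (s n - l)) \<longlonglongrightarrow> 0"
proof -
  have "uniformly_Cauchy_on UNIV (\<lambda>n. cfun_apply (s n))"
    unfolding uniformly_Cauchy_on_def
  proof (intro allI impI)
    fix e :: real assume "0 < e"
    then obtain n0 where n0: "\<forall>m\<ge>n0. \<forall>n\<ge>n0. cfun_norm (s m - s n) < e"
      using assms by blast
    have "dist (cfun_apply (s m) x) (cfun_apply (s n) x) \<le> cfun_norm (s m - s n)" for m n x
      using absval_le_cfun_norm[of "s m - s n" x] by (simp add: dist_absval)
    then show "\<exists>M. \<forall>x\<in>UNIV. \<forall>m\<ge>M. \<forall>n\<ge>M. dist (cfun_apply (s m) x) (cfun_apply (s n) x) < e"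
      using n0 by (metis le_less_trans)
  qed
  then obtain l where l: "uniform_limit UNIV (\<lambda>n. cfun_apply (s n)) l sequentially"
    using Cauchy_uniformly_convergent uniformly_convergent_on_def by blast
  then have "continuous_on UNIV l"
    by (rule uniform_limit_theorem[rotated]) (auto simp: continuous_cfun_apply)
  then have l': "cfun_apply (Abs_cfun l) = l"
    by (simp add: Abs_cfun_inverse)
  have "(\<lambda>n. cfun_norm (s n - Abs_cfun l)) \<longlonglongrightarrow> 0"
  proof (rule tendstoI)
    fix e :: real assume e: "0 < e"
    then have "eventually (\<lambda>n. \<forall>x\<in>UNIV. dist (cfun_apply (s n) x) (l x) < e / 2) sequentially"
      by (intro uniform_limitD[OF l]) simp
    then show "eventually (\<lambda>n. dist (cfun_norm (s n - Abs_cfun l)) 0 < e) sequentially"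
    proof (rule eventually_mono)
      fix n assume n: "\<forall>x\<in>UNIV. dist (cfun_apply (s n) x) (l x) < e / 2"
      have "cfun_norm (s n - Abs_cfun l) \<le> e / 2"
        using n by (intro cfun_norm_le) (auto simp: l' dist_absval less_imp_le)
      then show "dist (cfun_norm (s n - Abs_cfun l)) 0 < e"
        using e cfun_norm_nonneg[of "s n - Abs_cfun l"] by (simp add: dist_real_def)
    qed
  qed
  then show ?thesis by blast
qed

lemma nonarch_banach_cfun:
  "nonarch_banach (cfun_scale :: 'k::{nonarch_valued_field, complete_space} \<Rightarrow> ('m, 'k) cfun \<Rightarrow> _) cfun_norm"
  by (intro nonarch_banach.intro vector_space_cfun nonarch_banach_axioms.intro
      cfun_norm_nonneg cfun_norm_eq_0_iff cfun_norm_scale cfun_norm_ultrametric cfun_complete)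

lemma cfun_norm_square:
  "cfun_norm (cfun_mult f f) = (cfun_norm (f :: ('m, 'k::nonarch_valued_field) cfun))\<^sup>2"
proof (rule antisym)
  show "cfun_norm (cfun_mult f f) \<le> (cfun_norm f)\<^sup>2"
    using cfun_norm_mult_le[of f f] by (simp add: power2_eq_square)
  have "cfun_norm f \<le> sqrt (cfun_norm (cfun_mult f f))"
  proof (rule cfun_norm_le)
    fix m
    show "absval (cfun_apply f m) \<le> sqrt (cfun_norm (cfun_mult f f))"
      using absval_le_cfun_norm[of "cfun_mult f f" m]
      by (intro real_le_rsqrt) (simp add: absval_mult power2_eq_square)
  qed
  then show "(cfun_norm f)\<^sup>2 \<le> cfun_norm (cfun_mult f f)"
    using cfun_norm_nonneg by (metis power_mono real_sqrt_pow2)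
qed

text \<open>The supremum that defines the operator norm is attained at the constant function 1.\<close>

lemma op_norm_cfun_mult: "op_norm cfun_norm (cfun_mult f) = cfun_norm (f :: ('m, 'k::nonarch_valued_field) cfun)"
  unfolding op_norm_def
proof (rule cSup_eq_maximum)
  have one: "cfun_norm (cfun_const 1 :: ('m, 'k) cfun) = 1"
    by (simp add: cfun_norm_const absval_one)
  then have "(cfun_const 1 :: ('m, 'k) cfun) \<noteq> 0"
    using cfun_norm_eq_0_iff by force
  then show "cfun_norm f \<in> (\<lambda>v. cfun_norm (cfun_mult f v) / cfun_norm v) ` {v. v \<noteq> 0}"
    by (intro image_eqI[of _ _ "cfun_const 1"]) (simp_all add: one cfun_mult_one)
next
  fix r assume "r \<in> (\<lambda>v. cfun_norm (cfun_mult f v) / cfun_norm v) ` {v. v \<noteq> 0}"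
  then obtain v where v: "v \<noteq> 0" "r = cfun_norm (cfun_mult f v) / cfun_norm v" by blast
  then have "0 < cfun_norm v"
    using cfun_norm_nonneg[of v] cfun_norm_eq_0_iff[of v] by simp
  then show "r \<le> cfun_norm f"
    unfolding v(2) using cfun_norm_mult_le[of f v] by (simp add: pos_divide_le_eq)
qed

end

section \<open>Bounded operators\<close>

lemma (in nonarch_banach) bounded_op_iff:
  "bounded_op smul nrm T \<longleftrightarrow> (\<forall>v w. T (v + w) = T v + T w) \<and> (\<forall>c v. T (smul c v) = smul c (T v)) \<and>
    (\<exists>C. \<forall>v. nrm (T v) \<le> C * nrm v)"
  by (auto simp: bounded_op_def Vector_Spaces.linear_iff vector_space_axioms)

lemma (in nonarch_banach) nrm_minus: "nrm (- v) = nrm v"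
  using nrm_scale[of "- 1" v] by (simp add: absval_minus absval_one)

lemma (in nonarch_banach) nrm_diff_le: "nrm (v - w) \<le> max (nrm v) (nrm w)"
  using nrm_ultrametric[of v "- w"] by (simp add: nrm_minus)

lemma (in nonarch_banach) bounded_op_diff:
  assumes "bounded_op smul nrm S" "bounded_op smul nrm T"
  shows "bounded_op smul nrm (\<lambda>v. S v - T v)"
proof -
  obtain C D where CD: "\<And>v. nrm (S v) \<le> C * nrm v" "\<And>v. nrm (T v) \<le> D * nrm v"
    using assms by (auto simp: bounded_op_iff)
  have "nrm (S v - T v) \<le> max C D * nrm v" for v
  proof -
    have "C * nrm v \<le> max C D * nrm v" "D * nrm v \<le> max C D * nrm v"
      by (auto intro!: mult_right_mono nrm_nonneg)
    then show ?thesis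
      using nrm_diff_le[of "S v" "T v"] CD[of v] by linarith
  qed
  then show ?thesis
    using assms by (auto simp: bounded_op_iff scale_right_diff_distrib)
qed

lemma (in nonarch_banach) nrm_le_op_norm:
  assumes "bounded_op smul nrm T"
  shows "nrm (T v) \<le> op_norm nrm T * nrm v"
proof (cases "v = 0")
  case True
  moreover have "T 0 + T 0 = T 0"
    using assms by (metis bounded_op_iff add_0)
  ultimately show ?thesis
    using nrm_eq_0_iff[of 0] by simp
next
  case False
  obtain C where C: "\<And>v. nrm (T v) \<le> C * nrm v"
    using assms by (auto simp: bounded_op_iff)
  have pos: "0 < nrm v" if "v \<noteq> 0" for v
    using that nrm_nonneg[of v] nrm_eq_0_iff[of v] by simp
  have "nrm (T v) / nrm v \<le> op_norm nrm T"
    unfolding op_norm_def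
    using C pos False by (intro cSUP_upper bdd_aboveI2[of _ _ C]) (auto simp: divide_le_eq)
  then show ?thesis
    using pos[OF False] by (simp add: field_simps)
qed

section \<open>The algebra generated by a multiplication operator\<close>

locale compact_multiplication =
  fixes a :: "('m::topological_space, 'k::{nonarch_valued_field, complete_space}) cfun"
  assumes compact: "compact (UNIV :: 'm set)"
begin

sublocale nonarch_banach cfun_scale "cfun_norm :: ('m, 'k) cfun \<Rightarrow> real"
  by (rule nonarch_banach_cfun[OF compact])

abbreviation L where "L \<equiv> gen_algebra cfun_scale cfun_norm (cfun_mult a)"
abbreviation points where "points \<equiv> berkovich_points L (op_norm cfun_norm)"
abbreviation spectrum where "spectrum \<equiv> berkovich_spectrum L (op_norm cfun_norm)"
abbreviation val where "val \<equiv> character_value cfun_scale cfun_norm (cfun_mult a)"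

definition poly_closure :: "('m, 'k) cfun set" where
  "poly_closure = {f. \<forall>\<epsilon>>0. \<exists>p. cfun_norm (f - cfun_poly p a) < \<epsilon>}"

lemma poly_closureE:
  assumes "f \<in> poly_closure" "0 < \<epsilon>"
  obtains p where "cfun_norm (f - cfun_poly p a) < \<epsilon>"
  using assms by (auto simp: poly_closure_def)

lemma bounded_op_cfun_mult: "bounded_op cfun_scale cfun_norm (cfun_mult (f :: ('m, 'k) cfun))"
  unfolding bounded_op_iff using cfun_norm_mult_le[OF compact]
  by (auto intro!: cfun_eqI simp: algebra_simps)

lemma cfun_scale_eq_mult: "cfun_scale c = cfun_mult (cfun_const c :: ('m, 'k) cfun)"
  by (auto intro!: cfun_eqI)

lemma cfun_apply_sum: "cfun_apply (\<Sum>i\<in>I. f i) m = (\<Sum>i\<in>I. cfun_apply (f i :: ('m, 'k) cfun) m)"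
  by (induction I rule: infinite_finite_induct) auto

lemma poly_op_eq: "poly_op cfun_scale p (cfun_mult a) = cfun_mult (cfun_poly p a)"
proof
  fix v
  have "cfun_apply ((cfun_mult a ^^ i) v) m = cfun_apply a m ^ i * cfun_apply v m" for i m
    by (induction i) auto
  then show "poly_op cfun_scale p (cfun_mult a) v = cfun_mult (cfun_poly p a) v"
    by (intro cfun_eqI)
      (simp add: poly_op_def cfun_apply_sum poly_altdef sum_distrib_right mult.assoc)
qed

lemma cfun_mult_inject: "cfun_mult f = cfun_mult g \<longleftrightarrow> f = (g :: ('m, 'k) cfun)"
  by (metis cfun_mult_one)

text \<open>An operator \<open>T\<close> in the closure is multiplication by \<open>f = T 1\<close>. If \<open>T\<close> is within \<open>\<epsilon>\<close> of
  multiplication by \<open>p \<circ> a\<close>, then so is \<open>f\<close> of \<open>p \<circ> a\<close>, hence \<open>T v\<close> and \<open>f v\<close> are both within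
  \<open>\<epsilon> \<parallel>v\<parallel>\<close> of \<open>(p \<circ> a) v\<close>.\<close>

lemma carrier_gen_algebra: "carrier L = cfun_mult ` poly_closure"
proof (intro equalityI subsetI)
  fix T assume "T \<in> cfun_mult ` poly_closure"
  then obtain f where f: "f \<in> poly_closure" "T = cfun_mult f" by blast
  have "(\<lambda>v. cfun_mult f v - poly_op cfun_scale p (cfun_mult a) v) = cfun_mult (f - cfun_poly p a)" for p
    by (auto simp: poly_op_eq algebra_simps intro!: cfun_eqI)
  then show "T \<in> carrier L"
    using f by (simp add: gen_algebra_def bounded_op_cfun_mult poly_closure_def op_norm_cfun_mult[OF compact])
next
  fix T assume "T \<in> carrier L"
  then have T: "bounded_op cfun_scale cfun_norm T"
    "\<And>\<epsilon>. 0 < \<epsilon> \<Longrightarrow> \<exists>p. op_norm cfun_norm (\<lambda>v. T v - cfun_mult (cfun_poly p a) v) < \<epsilon>"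
    by (auto simp: gen_algebra_def poly_op_eq)
  define f where "f = T (cfun_const 1)"
  have approx: "\<exists>p. \<forall>v. cfun_norm (T v - cfun_mult (cfun_poly p a) v) \<le> \<epsilon> * cfun_norm v"
    if pos: "0 < \<epsilon>" for \<epsilon>
  proof -
    obtain p where p: "op_norm cfun_norm (\<lambda>v. T v - cfun_mult (cfun_poly p a) v) < \<epsilon>"
      using T(2)[OF pos] by blast
    have "cfun_norm (T v - cfun_mult (cfun_poly p a) v) \<le> \<epsilon> * cfun_norm v" for v
      using nrm_le_op_norm[OF bounded_op_diff[OF T(1) bounded_op_cfun_mult], of v "cfun_poly p a"]
        mult_right_mono[OF less_imp_le[OF p] nrm_nonneg[of v]] by linarith
    then show ?thesis by blast
  qed
  have f_approx: "cfun_norm (f - cfun_poly p a) \<le> \<epsilon>"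
    if "\<forall>v. cfun_norm (T v - cfun_mult (cfun_poly p a) v) \<le> \<epsilon> * cfun_norm v" for p \<epsilon>
    using spec[OF that, of "cfun_const 1"]
    by (simp add: cfun_mult_one f_def[symmetric] cfun_norm_const absval_one)
  have "f \<in> poly_closure"
    unfolding poly_closure_def
  proof (intro CollectI allI impI)
    fix \<epsilon> :: real assume "0 < \<epsilon>"
    then obtain p where "\<forall>v. cfun_norm (T v - cfun_mult (cfun_poly p a) v) \<le> \<epsilon> / 2 * cfun_norm v"
      using approx[of "\<epsilon> / 2"] by auto
    from f_approx[OF this] show "\<exists>p. cfun_norm (f - cfun_poly p a) < \<epsilon>"
      using \<open>0 < \<epsilon>\<close> by (intro exI[of _ p]) linarith
  qed
  moreover have "T = cfun_mult f"
  proof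
    fix v
    have "cfun_norm (T v - cfun_mult f v) \<le> 0 + e" if "0 < e" for e
    proof -
      define \<epsilon> where "\<epsilon> = e / (cfun_norm v + 1)"
      have v: "0 \<le> cfun_norm v" by (rule nrm_nonneg)
      have \<epsilon>: "0 < \<epsilon>" "\<epsilon> * cfun_norm v \<le> e"
        using that v by (auto simp: \<epsilon>_def field_simps)
      obtain p where p: "\<forall>v. cfun_norm (T v - cfun_mult (cfun_poly p a) v) \<le> \<epsilon> * cfun_norm v"
        using approx[OF \<epsilon>(1)] by blast
      have "T v - cfun_mult f v = (T v - cfun_mult (cfun_poly p a) v) - cfun_mult (f - cfun_poly p a) v"
        by (rule cfun_eqI) (simp add: algebra_simps)
      then have "cfun_norm (T v - cfun_mult f v) \<le>
          max (cfun_norm (T v - cfun_mult (cfun_poly p a) v)) (cfun_norm (cfun_mult (f - cfun_poly p a) v))"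
        using nrm_diff_le by metis
      also have "\<dots> \<le> \<epsilon> * cfun_norm v"
        using p cfun_norm_mult_le[OF compact, of "f - cfun_poly p a" v] mult_right_mono[OF f_approx[OF p] v]
        by auto
      finally show ?thesis using \<epsilon> by linarith
    qed
    then have "cfun_norm (T v - cfun_mult f v) \<le> 0"
      by (rule field_le_epsilon)
    then have "T v - cfun_mult f v = 0"
      using nrm_eq_0_iff nrm_nonneg order.antisym by blast
    then show "T v = cfun_mult f v" by simp
  qed
  ultimately show "T \<in> cfun_mult ` poly_closure" by blast
qed

lemma poly_in_poly_closure: "cfun_poly p a \<in> poly_closure"
  using nrm_eq_0_iff[of 0] by (auto simp: poly_closure_def intro!: exI[of _ p])

lemma const_in_poly_closure: "cfun_const c \<in> poly_closure"
proof -
  have "cfun_const c = cfun_poly [:c:] a"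
    by (rule cfun_eqI) simp
  then show ?thesis using poly_in_poly_closure by metis
qed

lemma self_in_poly_closure: "a \<in> poly_closure"
proof -
  have "a = cfun_poly [:0, 1:] a"
    by (rule cfun_eqI) simp
  then show ?thesis using poly_in_poly_closure by metis
qed

lemma add_in_poly_closure:
  assumes "f \<in> poly_closure" "g \<in> poly_closure"
  shows "f + g \<in> poly_closure"
  unfolding poly_closure_def
proof (intro CollectI allI impI)
  fix \<epsilon> :: real assume "0 < \<epsilon>"
  then obtain p q where pq: "cfun_norm (f - cfun_poly p a) < \<epsilon>" "cfun_norm (g - cfun_poly q a) < \<epsilon>"
    using assms poly_closureE by metis
  have "f + g - cfun_poly (p + q) a = (f - cfun_poly p a) + (g - cfun_poly q a)"
    by (rule cfun_eqI) simp
  then have "cfun_norm (f + g - cfun_poly (p + q) a) \<le> max (cfun_norm (f - cfun_poly p a)) (cfun_norm (g - cfun_poly q a))"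
    using nrm_ultrametric by metis
  then show "\<exists>p. cfun_norm (f + g - cfun_poly p a) < \<epsilon>"
    using pq by (intro exI[of _ "p + q"]) linarith
qed

lemma mult_in_poly_closure:
  assumes "f \<in> poly_closure" "g \<in> poly_closure"
  shows "cfun_mult f g \<in> poly_closure"
  unfolding poly_closure_def
proof (intro CollectI allI impI)
  fix \<epsilon> :: real assume \<epsilon>: "0 < \<epsilon>"
  have approx: "\<exists>p. cfun_norm (h - cfun_poly p a) * B < \<epsilon>" if h: "h \<in> poly_closure" "0 \<le> B" for h B
  proof -
    have "0 < \<epsilon> / (B + 1)"
      using \<epsilon> h(2) by simp
    then
    obtain p where p: "cfun_norm (h - cfun_poly p a) < \<epsilon> / (B + 1)"
      using poly_closureE[OF h(1)] by blast
    have "cfun_norm (h - cfun_poly p a) * B \<le> cfun_norm (h - cfun_poly p a) * (B + 1)"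
      by (intro mult_left_mono nrm_nonneg) simp
    also have "\<dots> < \<epsilon>"
      using p h(2) by (simp add: field_simps)
    finally show ?thesis by blast
  qed
  obtain p where p: "cfun_norm (f - cfun_poly p a) * cfun_norm g < \<epsilon>"
    using approx[OF assms(1) nrm_nonneg] by blast
  obtain q where q: "cfun_norm (g - cfun_poly q a) * cfun_norm (cfun_poly p a) < \<epsilon>"
    using approx[OF assms(2) nrm_nonneg] by blast
  have "cfun_mult f g - cfun_poly (p * q) a =
      cfun_mult (f - cfun_poly p a) g + cfun_mult (g - cfun_poly q a) (cfun_poly p a)"
    by (rule cfun_eqI) (simp add: algebra_simps)
  then have "cfun_norm (cfun_mult f g - cfun_poly (p * q) a) \<le>
      max (cfun_norm (cfun_mult (f - cfun_poly p a) g)) (cfun_norm (cfun_mult (g - cfun_poly q a) (cfun_poly p a)))"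
    using nrm_ultrametric by metis
  also have "\<dots> < \<epsilon>"
    using p q cfun_norm_mult_le[OF compact, of "f - cfun_poly p a" g]
      cfun_norm_mult_le[OF compact, of "g - cfun_poly q a" "cfun_poly p a"] by linarith
  finally show "\<exists>p. cfun_norm (cfun_mult f g - cfun_poly p a) < \<epsilon>"
    by blast
qed

lemma uminus_in_poly_closure: "f \<in> poly_closure \<Longrightarrow> - f \<in> poly_closure"
proof -
  have "- f = cfun_mult (cfun_const (- 1)) f"
    by (rule cfun_eqI) simp
  then show "f \<in> poly_closure \<Longrightarrow> - f \<in> poly_closure"
    using mult_in_poly_closure const_in_poly_closure by metis
qed

lemma gen_algebra_ops:
  "cfun_mult f \<oplus>\<^bsub>L\<^esub> cfun_mult g = cfun_mult (f + g)"
  "cfun_mult f \<otimes>\<^bsub>L\<^esub> cfun_mult g = cfun_mult (cfun_mult f g)"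
  "\<zero>\<^bsub>L\<^esub> = cfun_mult (cfun_const 0)"
  "\<one>\<^bsub>L\<^esub> = cfun_mult (cfun_const 1)"
  by (auto simp: gen_algebra_def fun_eq_iff algebra_simps intro!: cfun_eqI)

lemma ring_gen_algebra: "ring L"
proof (intro ringI abelian_groupI monoidI)
  fix x assume "x \<in> carrier L"
  then obtain f where "f \<in> poly_closure" "x = cfun_mult f"
    by (auto simp: carrier_gen_algebra)
  then show "\<exists>y\<in>carrier L. y \<oplus>\<^bsub>L\<^esub> x = \<zero>\<^bsub>L\<^esub>"
    using uminus_in_poly_closure
    by (auto simp: carrier_gen_algebra gen_algebra_ops cfun_mult_inject intro!: cfun_eqI bexI[of _ "- f"])
qed (auto simp: carrier_gen_algebra gen_algebra_ops cfun_mult_inject algebra_simps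
    add_in_poly_closure mult_in_poly_closure const_in_poly_closure intro!: cfun_eqI)

lemma op_norm_square: "T \<in> carrier L \<Longrightarrow> op_norm cfun_norm (T \<circ> T) = (op_norm cfun_norm T)\<^sup>2"
proof -
  assume "T \<in> carrier L"
  then obtain f where f: "T = cfun_mult f"
    by (auto simp: carrier_gen_algebra)
  have "T \<circ> T = cfun_mult (cfun_mult f f)"
    by (auto simp: f intro!: cfun_eqI)
  then show ?thesis
    by (simp add: op_norm_cfun_mult[OF compact] cfun_norm_square[OF compact] f)
qed

section \<open>The spectrum of the algebra\<close>

text \<open>For an element \<open>T\<close> of the algebra, \<open>T 1\<close> is the function by which \<open>T\<close> multiplies. The restriction
  to the carrier makes equality of points equality of functions.\<close>

definition evaluation_point :: "'m \<Rightarrow> (('m, 'k) cfun \<Rightarrow> ('m, 'k) cfun) \<Rightarrow> real" where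
  "evaluation_point m = restrict (\<lambda>T. absval (cfun_apply (T (cfun_const 1)) m)) (carrier L)"

lemma evaluation_point_mult:
  "f \<in> poly_closure \<Longrightarrow> evaluation_point m (cfun_mult f) = absval (cfun_apply f m)"
  by (simp add: evaluation_point_def carrier_gen_algebra)

lemma evaluation_point_in: "evaluation_point m \<in> points"
proof -
  have "evaluation_point m \<in> extensional (carrier L)"
    by (simp add: evaluation_point_def)
  moreover have "\<exists>C. \<forall>f\<in>poly_closure. absval (cfun_apply f m) \<le> C * cfun_norm f"
    using absval_le_cfun_norm[OF compact] by (intro exI[of _ 1]) auto
  ultimately show ?thesis
    by (simp add: berkovich_points_def carrier_gen_algebra gen_algebra_ops evaluation_point_mult
        add_in_poly_closure mult_in_poly_closure const_in_poly_closure
        absval_nonneg absval_triangle absval_zero absval_one op_norm_cfun_mult[OF compact] absval_mult)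
qed

text \<open>The definition of a point, stated for functions in place of the operators that multiply by them.\<close>

lemma berkovich_pointD:
  assumes "x \<in> points"
  obtains C where
    "\<And>f. f \<in> poly_closure \<Longrightarrow> 0 \<le> x (cfun_mult f)"
    "x (cfun_mult (cfun_const 0)) = 0"
    "x (cfun_mult (cfun_const 1)) = 1"
    "\<And>f g. f \<in> poly_closure \<Longrightarrow> g \<in> poly_closure \<Longrightarrow> x (cfun_mult (f + g)) \<le> x (cfun_mult f) + x (cfun_mult g)"
    "\<And>f g. f \<in> poly_closure \<Longrightarrow> g \<in> poly_closure \<Longrightarrow> x (cfun_mult (cfun_mult f g)) = x (cfun_mult f) * x (cfun_mult g)"
    "\<And>f. f \<in> poly_closure \<Longrightarrow> x (cfun_mult f) \<le> C * cfun_norm f"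
proof -
  obtain C where "\<forall>f\<in>poly_closure. x (cfun_mult f) \<le> C * cfun_norm f"
    using assms by (auto simp: berkovich_points_def carrier_gen_algebra op_norm_cfun_mult[OF compact])
  then show ?thesis
    using assms by (intro that[of C])
      (simp_all add: berkovich_points_def carrier_gen_algebra gen_algebra_ops)
qed

text \<open>Along \<open>p \<mapsto> p(A)\<close> the point becomes a seminorm on polynomials that is bounded by the supremum
  on \<open>a(M)\<close>, hence an evaluation at some \<open>a(m)\<close>. Both the point and the evaluation at \<open>m\<close> are
  continuous for the norm, so they agree on the closure of the polynomials.\<close>

lemma berkovich_point_is_evaluation:
  assumes x: "x \<in> points"
  shows "\<exists>m. x = evaluation_point m"
proof -
  obtain C where nonneg: "\<And>f. f \<in> poly_closure \<Longrightarrow> 0 \<le> x (cfun_mult f)"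
    and zero: "x (cfun_mult (cfun_const 0)) = 0"
    and one: "x (cfun_mult (cfun_const 1)) = 1"
    and add: "\<And>f g. f \<in> poly_closure \<Longrightarrow> g \<in> poly_closure \<Longrightarrow> x (cfun_mult (f + g)) \<le> x (cfun_mult f) + x (cfun_mult g)"
    and mult: "\<And>f g. f \<in> poly_closure \<Longrightarrow> g \<in> poly_closure \<Longrightarrow> x (cfun_mult (cfun_mult f g)) = x (cfun_mult f) * x (cfun_mult g)"
    and bound: "\<And>f. f \<in> poly_closure \<Longrightarrow> x (cfun_mult f) \<le> C * cfun_norm f"
    using berkovich_pointD[OF x] by blast
  have C: "0 \<le> C"
    using bound[OF const_in_poly_closure[of 1]] one by (simp add: cfun_norm_const absval_one)
  interpret W: bounded_poly_seminorm "range (cfun_apply a)" "\<lambda>p. x (cfun_mult (cfun_poly p a))" C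
  proof
    show "compact (range (cfun_apply a))"
      by (intro compact_continuous_image continuous_cfun_apply compact)
    have "cfun_poly 1 a = cfun_const 1" "cfun_poly 0 a = cfun_const 0"
      by (auto intro!: cfun_eqI)
    then show "x (cfun_mult (cfun_poly 1 a)) = 1" "x (cfun_mult (cfun_poly 0 a)) = 0"
      by (simp_all add: one zero)
  next
    fix p q
    have "cfun_poly (p + q) a = cfun_poly p a + cfun_poly q a"
      "cfun_poly (p * q) a = cfun_mult (cfun_poly p a) (cfun_poly q a)"
      by (auto intro!: cfun_eqI)
    then show "x (cfun_mult (cfun_poly (p + q) a)) \<le> x (cfun_mult (cfun_poly p a)) + x (cfun_mult (cfun_poly q a))"
      "x (cfun_mult (cfun_poly (p * q) a)) = x (cfun_mult (cfun_poly p a)) * x (cfun_mult (cfun_poly q a))"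
      by (simp_all add: add mult poly_in_poly_closure)
    show "0 \<le> x (cfun_mult (cfun_poly p a))"
      by (intro nonneg poly_in_poly_closure)
    fix B assume "\<forall>z\<in>range (cfun_apply a). absval (poly p z) \<le> B"
    then have "cfun_norm (cfun_poly p a) \<le> B"
      by (intro cfun_norm_le) auto
    then show "x (cfun_mult (cfun_poly p a)) \<le> C * B"
      using bound[OF poly_in_poly_closure, of p] mult_left_mono[OF _ C] order_trans by blast
  qed
  obtain m where m: "\<And>p. x (cfun_mult (cfun_poly p a)) = absval (poly p (cfun_apply a m))"
    using W.eq_absval_evaluation by auto
  have "x (cfun_mult f) = absval (cfun_apply f m)" if f: "f \<in> poly_closure" for f
  proof -
    have "\<bar>x (cfun_mult f) - absval (cfun_apply f m)\<bar> \<le> 0 + e" if e: "0 < e" for e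
    proof -
      have "0 < e / (C + 1)"
        using e C by simp
      then obtain p where p: "cfun_norm (f - cfun_poly p a) < e / (C + 1)"
        using poly_closureE[OF f] by blast
      let ?p = "cfun_poly p a" and ?d = "cfun_norm (f - cfun_poly p a)"
      have mem: "f - ?p \<in> poly_closure" "?p - f \<in> poly_closure"
        using add_in_poly_closure[OF f uminus_in_poly_closure[OF poly_in_poly_closure, of p]]
          add_in_poly_closure[OF poly_in_poly_closure uminus_in_poly_closure[OF f], of p] by simp_all
      have "x (cfun_mult (?p + (f - ?p))) \<le> x (cfun_mult ?p) + C * ?d"
        using add[OF poly_in_poly_closure mem(1), of p] bound[OF mem(1)] by linarith
      moreover have "x (cfun_mult (f + (?p - f))) \<le> x (cfun_mult f) + C * ?d"
        using add[OF f mem(2)] bound[OF mem(2)] nrm_minus[of "f - ?p"] by simp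
      ultimately have "\<bar>x (cfun_mult f) - absval (poly p (cfun_apply a m))\<bar> \<le> C * ?d"
        by (simp add: m)
      moreover have "\<bar>absval (poly p (cfun_apply a m)) - absval (cfun_apply f m)\<bar> \<le> ?d"
        using absval_diff_le[of "cfun_apply f m" "poly p (cfun_apply a m)"]
          absval_le_cfun_norm[OF compact, of "f - ?p" m] by simp
      moreover have "C * ?d + ?d \<le> e"
        using p C by (simp add: field_simps)
      ultimately show ?thesis by linarith
    qed
    then have "\<bar>x (cfun_mult f) - absval (cfun_apply f m)\<bar> \<le> 0"
      by (rule field_le_epsilon)
    then show ?thesis by simp
  qed
  then have "x = evaluation_point m"
    using x by (intro extensionalityI[of x "carrier L"])
      (auto simp: berkovich_points_def evaluation_point_def carrier_gen_algebra)
  then show ?thesis by blast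
qed

lemma berkovich_points_eq: "points = range evaluation_point"
  using berkovich_point_is_evaluation evaluation_point_in by blast

lemma cfun_scale_in: "cfun_scale c \<in> carrier L"
  by (simp add: cfun_scale_eq_mult carrier_gen_algebra const_in_poly_closure)

text \<open>At the point of \<open>m\<close> the homomorphism is \<open>f \<mapsto> f(m)\<close>; scalar multiplications provide the section.\<close>

lemma scalar_valued_evaluation:
  "scalar_valued_point L (\<lambda>T. cfun_apply (T (cfun_const 1)) m) cfun_scale (evaluation_point m)"
proof (intro scalar_valued_point.intro ring_gen_algebra scalar_valued_point_axioms.intro)
qed (auto simp: carrier_gen_algebra gen_algebra_ops cfun_scale_in[unfolded carrier_gen_algebra] evaluation_point_mult)

lemma normal: "normal_op cfun_scale cfun_norm (cfun_mult a)"
  unfolding normal_op_def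
  using scalar_valued_point.completed_residue_field_eq[OF scalar_valued_evaluation]
    nonarch_banach_axioms bounded_op_cfun_mult op_norm_square
  by (auto simp: berkovich_points_eq)

lemma character_value_evaluation:
  "val (evaluation_point m) = cfun_apply a m"
  unfolding character_value_def
proof (rule the_equality)
  have "cfun_mult a \<in> carrier L"
    by (simp add: carrier_gen_algebra self_in_poly_closure)
  from scalar_valued_point.character_eq[OF scalar_valued_evaluation this]
  show eq: "berkovich_character L (evaluation_point m) (cfun_mult a) =
      berkovich_character L (evaluation_point m) (cfun_scale (cfun_apply a m))"
    by (simp add: cfun_mult_one)
  fix c assume "berkovich_character L (evaluation_point m) (cfun_mult a) =
      berkovich_character L (evaluation_point m) (cfun_scale c)"
  then show "c = cfun_apply a m"
    using scalar_valued_point.character_iota_inject[OF scalar_valued_evaluation] eq by metis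
qed

text \<open>If \<open>c = a(m)\<close>, every function in the range of \<open>A - c\<close> vanishes at \<open>m\<close>, so the constant 1 is not
  in it. Otherwise the inverse is multiplication by the continuous function \<open>1 / (a - c)\<close>.\<close>

lemma op_spectrum_eq: "op_spectrum cfun_scale cfun_norm (cfun_mult a) = range (cfun_apply a)"
proof (intro equalityI subsetI)
  fix c assume "c \<in> range (cfun_apply a)"
  then obtain m where m: "c = cfun_apply a m" by blast
  have False if "(\<lambda>v. cfun_mult a v - cfun_scale c v) \<circ> B = id" for B
  proof -
    have "cfun_mult a (B (cfun_const 1)) - cfun_scale c (B (cfun_const 1)) = cfun_const 1"
      using fun_cong[OF that, of "cfun_const 1"] by simp
    then have "cfun_apply (cfun_mult a (B (cfun_const 1)) - cfun_scale c (B (cfun_const 1))) m = 1"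
      by simp
    then show False by (simp add: m)
  qed
  then show "c \<in> op_spectrum cfun_scale cfun_norm (cfun_mult a)"
    by (auto simp: op_spectrum_def)
next
  fix c assume c: "c \<in> op_spectrum cfun_scale cfun_norm (cfun_mult a)"
  show "c \<in> range (cfun_apply a)"
  proof (rule ccontr)
    assume "c \<notin> range (cfun_apply a)"
    then have nz: "cfun_apply a m - c \<noteq> 0" for m by auto
    define b where "b = Abs_cfun (\<lambda>m. inverse (cfun_apply a m - c))"
    have "continuous_on UNIV (\<lambda>m. inverse (cfun_apply a m - c))"
      unfolding continuous_on_def
    proof
      fix m
      show "((\<lambda>m. inverse (cfun_apply a m - c)) \<longlongrightarrow> inverse (cfun_apply a m - c)) (at m within UNIV)"
        using continuous_cfun_apply[of UNIV a] nz
        by (intro tendsto_inverse_valued tendsto_diff tendsto_const) (auto simp: continuous_on_def)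
    qed
    then have b: "cfun_apply b m = inverse (cfun_apply a m - c)" for m
      by (simp add: b_def Abs_cfun_inverse)
    have "cfun_mult b \<circ> (\<lambda>v. cfun_mult a v - cfun_scale c v) = id"
      "(\<lambda>v. cfun_mult a v - cfun_scale c v) \<circ> cfun_mult b = id"
      using nz by (auto simp: fun_eq_iff b field_simps intro!: cfun_eqI)
    then show False
      using c bounded_op_cfun_mult by (auto simp: op_spectrum_def)
  qed
qed

text \<open>Functions \<open>p \<circ> a\<close> are constant on the fibres of \<open>a\<close>, and so are their limits.\<close>

lemma poly_closure_factors:
  assumes "f \<in> poly_closure" "cfun_apply a m = cfun_apply a m'"
  shows "cfun_apply f m = cfun_apply f m'"
proof -
  have "dist (cfun_apply f m) (cfun_apply f m') \<le> 0 + e" if "0 < e" for e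
  proof -
    obtain p where p: "cfun_norm (f - cfun_poly p a) < e"
      using poly_closureE[OF assms(1) \<open>0 < e\<close>] .
    have "dist (cfun_apply f z) (poly p (cfun_apply a z)) \<le> e" for z
      using absval_le_cfun_norm[OF compact, of "f - cfun_poly p a" z] p by (simp add: dist_absval)
    from this[of m] this[of m'] show ?thesis
      using assms(2) dist_ultrametric[of "cfun_apply f m" "cfun_apply f m'" "poly p (cfun_apply a m)"]
      by (auto simp: dist_commute)
  qed
  then have "dist (cfun_apply f m) (cfun_apply f m') \<le> 0"
    by (rule field_le_epsilon)
  then show ?thesis by simp
qed

lemma evaluation_point_cong:
  "cfun_apply a m = cfun_apply a m' \<Longrightarrow> evaluation_point m = evaluation_point m'"
  unfolding evaluation_point_def
  by (rule restrict_ext) (auto simp: carrier_gen_algebra cfun_mult_one dest: poly_closure_factors)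

lemma topspace_spectrum: "topspace spectrum = range evaluation_point"
proof -
  have "topspace spectrum = points"
    unfolding berkovich_spectrum_def topology_generated_by_topspace
    using cfun_scale_in by (auto intro!: exI[of _ UNIV])
  then show ?thesis by (simp add: berkovich_points_eq)
qed

text \<open>The distance of \<open>a(m)\<close> from \<open>c\<close> is the value of the point of \<open>m\<close> at \<open>A - c\<close>, and such values
  depend continuously on the point by the definition of the topology.\<close>

lemma openin_spectrum_ball:
  "openin spectrum {evaluation_point m | m. dist (cfun_apply a m) c < e}"
proof -
  let ?f = "a - cfun_const c"
  have f: "?f \<in> poly_closure"
    using add_in_poly_closure[OF self_in_poly_closure uminus_in_poly_closure[OF const_in_poly_closure]] by simp
  have "{evaluation_point m | m. dist (cfun_apply a m) c < e} =
      {x \<in> points. x (cfun_mult ?f) \<in> {..<e}}"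
    by (auto simp: berkovich_points_eq evaluation_point_mult[OF f] dist_absval)
  then show ?thesis
    unfolding berkovich_spectrum_def
    using f by (intro topology_generated_by_Basis CollectI exI[of _ "cfun_mult ?f"] exI[of _ "{..<e}"])
      (auto simp: carrier_gen_algebra)
qed

lemma continuous_character_value:
  "continuous_map spectrum (top_of_set (range (cfun_apply a))) val"
proof (rule continuous_map_into_subtopology)
  show "val \<in> topspace spectrum \<rightarrow> range (cfun_apply a)"
    by (auto simp: topspace_spectrum character_value_evaluation)
  show "continuous_map spectrum euclidean val"
    unfolding continuous_map_def
  proof (intro conjI allI impI)
    fix U :: "'k set" assume "openin euclidean U"
    then have U: "open U" by simp
    let ?P = "{x \<in> topspace spectrum. val x \<in> U}"
    have P: "?P = {evaluation_point m | m. cfun_apply a m \<in> U}"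
      by (auto simp: topspace_spectrum character_value_evaluation)
    show "openin spectrum ?P"
      unfolding P
    proof (subst openin_subopen, intro ballI)
      fix x assume "x \<in> {evaluation_point m | m. cfun_apply a m \<in> U}"
      then obtain m where m: "x = evaluation_point m" "cfun_apply a m \<in> U" by blast
      then obtain e where e: "0 < e" "\<And>z. dist z (cfun_apply a m) < e \<Longrightarrow> z \<in> U"
        using U by (auto simp: open_dist)
      show "\<exists>T. openin spectrum T \<and> x \<in> T \<and>
          T \<subseteq> {evaluation_point m | m. cfun_apply a m \<in> U}"
        using openin_spectrum_ball[of "cfun_apply a m" e] e m
        by (intro exI[of _ "{evaluation_point m' | m'. dist (cfun_apply a m') (cfun_apply a m) < e}"]) auto
    qed
  qed simp
qed

text \<open>By \<open>evaluation_point_cong\<close> the choice of a preimage of \<open>z\<close> is immaterial.\<close>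

definition point_of_value :: "'k \<Rightarrow> (('m, 'k) cfun \<Rightarrow> ('m, 'k) cfun) \<Rightarrow> real" where
  "point_of_value z = evaluation_point (SOME m. cfun_apply a m = z)"

lemma point_of_value_apply: "point_of_value (cfun_apply a m) = evaluation_point m"
  unfolding point_of_value_def
  by (intro evaluation_point_cong) (rule someI[of _ m], simp)

text \<open>The preimage of a subbasic open set \<open>{x. x(f) \<in> U}\<close> is the complement in \<open>a(M)\<close> of the image under
  \<open>a\<close> of the closed set where \<open>\<bar>f\<bar>\<close> is outside \<open>U\<close>. That image is compact, hence closed.\<close>

lemma continuous_point_of_value:
  "continuous_map (top_of_set (range (cfun_apply a))) spectrum point_of_value"
  unfolding berkovich_spectrum_def
proof (rule continuous_on_generated_topo)
  fix G assume "G \<in> {{x \<in> points. x f \<in> U} |f U. f \<in> carrier L \<and> open U}"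
  then obtain f U where f: "f \<in> poly_closure" and U: "open U"
    and G: "G = {x \<in> points. x (cfun_mult f) \<in> U}"
    by (auto simp: carrier_gen_algebra)
  let ?C = "{m. absval (cfun_apply f m) \<in> - U}"
  have "closed ?C"
    using closed_vimage[OF _ continuous_on_absval[OF continuous_cfun_apply[of UNIV f]], of "- U"] U
    by (auto simp: vimage_def closed_def)
  then have "compact (cfun_apply a ` ?C)"
    using compact_Int_closed[OF compact, of ?C]
    by (intro compact_continuous_image continuous_cfun_apply) simp
  then have "openin (top_of_set (range (cfun_apply a))) (range (cfun_apply a) - cfun_apply a ` ?C)"
    by (metis Diff_eq compact_imp_closed open_Compl openin_open_Int)
  also have "range (cfun_apply a) - cfun_apply a ` ?C = point_of_value -` G \<inter> topspace (top_of_set (range (cfun_apply a)))"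
  proof -
    have in_G: "point_of_value (cfun_apply a m) \<in> G \<longleftrightarrow> absval (cfun_apply f m) \<in> U" for m
      by (simp add: G point_of_value_apply evaluation_point_mult[OF f] evaluation_point_in)
    have "cfun_apply a m \<in> cfun_apply a ` ?C \<longleftrightarrow> absval (cfun_apply f m) \<notin> U" for m
    proof
      assume "cfun_apply a m \<in> cfun_apply a ` ?C"
      then obtain m' where "cfun_apply a m = cfun_apply a m'" "absval (cfun_apply f m') \<notin> U"
        by auto
      then show "absval (cfun_apply f m) \<notin> U"
        using poly_closure_factors[OF f, of m m'] by simp
    qed auto
    with in_G show ?thesis by auto
  qed
  finally show "openin (top_of_set (range (cfun_apply a))) (point_of_value -` G \<inter> topspace (top_of_set (range (cfun_apply a))))" .
next
  have "\<Union> {{x \<in> points. x f \<in> U} |f U. f \<in> carrier L \<and> open U} = range evaluation_point"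
    using topspace_spectrum by (simp add: berkovich_spectrum_def topology_generated_by_topspace)
  then show "point_of_value ` topspace (top_of_set (range (cfun_apply a)))
      \<subseteq> \<Union> {{x \<in> points. x f \<in> U} |f U. f \<in> carrier L \<and> open U}"
    by (auto simp: point_of_value_apply)
qed

lemma homeomorphic_map_character_value:
  "homeomorphic_map spectrum (top_of_set (range (cfun_apply a))) val"
  unfolding homeomorphic_map_maps homeomorphic_maps_def
  using continuous_character_value continuous_point_of_value
  by (intro exI[of _ point_of_value])
    (auto simp: topspace_spectrum point_of_value_apply character_value_evaluation)

lemma strongly_normal: "strongly_normal_op cfun_scale cfun_norm (cfun_mult a)"
  unfolding strongly_normal_op_def op_spectrum_eq
  using normal homeomorphic_map_character_value totally_disconnected_valued
    compact_continuous_image[OF continuous_cfun_apply compact]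
  by auto

end

theorem theorem2p2:
  fixes a :: "('m::t2_space, 'k::{nonarch_valued_field, alg_closed_field, complete_space}) cfun"
  assumes "compact (UNIV :: 'm set)"
    and "totally_disconnected (UNIV :: 'm set)"
  shows "strongly_normal_op cfun_scale cfun_norm (cfun_mult a)"
  using assms(1) by (intro compact_multiplication.strongly_normal compact_multiplication.intro)

end
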